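(* Let $R_0\ge0$. The strong coordination capacity region $\underline{\mathcal{C}}$ for the three-node no-communication network with common randomness at rate $R_0$ is the set of joint distributions $p(x,y,z)$ for which there exists a conditional distribution $p(u|x,y,z)$ of an auxiliary random variable $U$ with alphabet $\mathcal{U}$ such that $$p(x,y,z,u)=p(u)p(x|u)p(y|u)p(z|u),\qquad |\mathcal{U}|\le|\mathcal{X}||\mathcal{Y}||\mathcal{Z}|,\qquad R_0\ge I(X,Y,Z;U).$$
   Context: Alphabets $\mathcal{X},\mathcal{Y},\mathcal{Z}$ are finite; rates are in bits (logarithms base 2); $\{1,\dots,2^{nR_0}\}$ denotes the set of integers $k$ with $1\le k\le 2^{nR_0}$. No-communication network: the common randomness $\omega$ is uniformly distributed on $\{1,\dots,2^{nR_0}\}$. An $n$-block coordination code consists of three non-deterministic decoding functions $x^n(\omega),y^n(\omega),z^n(\omega)$ from $\{1,\dots,2^{nR_0}\}$ to $\mathcal{X}^n,\mathcal{Y}^n,\mathcal{Z}^n$ respectively, each using its own independent private randomness; i.e. they are specified by conditional probability mass functions $p(x^n|\omega),p(y^n|\omega),p(z^n|\omega)$, and $X^n,Y^n,Z^n$ are conditionally independent given $\omega$. The induced distribution $\tilde p(x^n,y^n,z^n)$ is the resulting joint distribution of $(X^n,Y^n,Z^n)$. A distribution $p(x,y,z)$ is strongly achievable (with common randomness rate $R_0$) if there exists a sequence of such coordination codes ($n=1,2,\dots$) with $\|\tilde p(x^n,y^n,z^n)-\prod_{i=1}^n p(x_i,y_i,z_i)\|_{TV}\to0$, where $\|p-q\|_{TV}=\frac12\sum|p-q|$.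 The strong coordination capacity region $\underline{\mathcal{C}}$ is the closure of the set of strongly achievable $p(x,y,z)$. *)

theory Defs
  imports "HOL-Probability.Probability"
begin

text \<open>
  The alphabets are finite types. An n-block over an alphabet is a list of length n, and a joint
  distribution is a pmf on triples. The common randomness ranges over the integers k with
  1 <= k <= 2 powr (n R0), also when 2 powr (n R0) is not an integer.
\<close>

definition common_randomness :: "real \<Rightarrow> nat \<Rightarrow> nat set" where
  "common_randomness R\<^sub>0 n = {k. 1 \<le> k \<and> real k \<le> 2 powr (real n * R\<^sub>0)}"

text \<open>A non-deterministic decoder is a conditional pmf of the output block given the common
  randomness. Its values outside the range of the common randomness are irrelevant.\<close>

definition is_decoder :: "real \<Rightarrow> nat \<Rightarrow> (nat \<Rightarrow> 'a list pmf) \<Rightarrow> bool" where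
  "is_decoder R\<^sub>0 n d \<longleftrightarrow>
     (\<forall>\<omega>\<in>common_randomness R\<^sub>0 n. \<forall>xs\<in>set_pmf (d \<omega>). length xs = n)"

text \<open>The private randomness of the decoders is independent, hence \<open>pair_pmf\<close>.\<close>

definition induced_pmf ::
  "real \<Rightarrow> nat \<Rightarrow> (nat \<Rightarrow> 'x list pmf) \<Rightarrow> (nat \<Rightarrow> 'y list pmf) \<Rightarrow> (nat \<Rightarrow> 'z list pmf)
    \<Rightarrow> ('x list \<times> 'y list \<times> 'z list) pmf" where
  "induced_pmf R\<^sub>0 n dx dy dz =
     bind_pmf (pmf_of_set (common_randomness R\<^sub>0 n))
       (\<lambda>\<omega>. pair_pmf (dx \<omega>) (pair_pmf (dy \<omega>) (dz \<omega>)))"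

definition blocks :: "nat \<Rightarrow> ('x list \<times> 'y list \<times> 'z list) set" where
  "blocks n = {(xs, ys, zs). length xs = n \<and> length ys = n \<and> length zs = n}"

definition iid_mass :: "('x \<times> 'y \<times> 'z) pmf \<Rightarrow> nat \<Rightarrow> 'x list \<times> 'y list \<times> 'z list \<Rightarrow> real" where
  "iid_mass p n = (\<lambda>(xs, ys, zs). \<Prod>i<n. pmf p (xs ! i, ys ! i, zs ! i))"

definition tv_dist :: "'a set \<Rightarrow> ('a \<Rightarrow> real) \<Rightarrow> ('a \<Rightarrow> real) \<Rightarrow> real" where
  "tv_dist A f g = (1 / 2) * (\<Sum>a\<in>A. \<bar>f a - g a\<bar>)"

definition strongly_achievable ::
  "real \<Rightarrow> ('x::finite \<times> 'y::finite \<times> 'z::finite) pmf \<Rightarrow> bool" where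
  "strongly_achievable R\<^sub>0 p \<longleftrightarrow>
     (\<exists>(dx :: nat \<Rightarrow> nat \<Rightarrow> 'x list pmf) (dy :: nat \<Rightarrow> nat \<Rightarrow> 'y list pmf)
        (dz :: nat \<Rightarrow> nat \<Rightarrow> 'z list pmf).
        (\<forall>n\<ge>1. is_decoder R\<^sub>0 n (dx n) \<and> is_decoder R\<^sub>0 n (dy n) \<and> is_decoder R\<^sub>0 n (dz n)) \<and>
        (\<lambda>n. tv_dist (blocks n) (pmf (induced_pmf R\<^sub>0 n (dx n) (dy n) (dz n))) (iid_mass p n))
          \<longlonglongrightarrow> 0)"

text \<open>The type of pmfs carries no topology; the closure is taken in the Euclidean space of mass
  vectors. The probability simplex is closed there, so no limit points are lost by restricting
  to pmfs.\<close>

definition pmf_vec :: "'a::finite pmf \<Rightarrow> real ^ 'a" where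
  "pmf_vec p = (\<chi> a. pmf p a)"

definition strong_capacity_region ::
  "real \<Rightarrow> ('x::finite \<times> 'y::finite \<times> 'z::finite) pmf set" where
  "strong_capacity_region R\<^sub>0 = {p. pmf_vec p \<in> closure (pmf_vec ` {q. strongly_achievable R\<^sub>0 q})}"

definition joint_pmf :: "'a pmf \<Rightarrow> ('a \<Rightarrow> 'u pmf) \<Rightarrow> ('a \<times> 'u) pmf" where
  "joint_pmf p W = bind_pmf p (\<lambda>a. map_pmf (Pair a) (W a))"

text \<open>For u of probability zero, \<open>cond_prob\<close> is 0 by division by zero and both sides vanish,
  so no side condition is needed.\<close>

definition factorizes :: "(('x \<times> 'y \<times> 'z) \<times> 'u) pmf \<Rightarrow> bool" where
  "factorizes J \<longleftrightarrow>
     (\<forall>x y z u. pmf J ((x, y, z), u) =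
        \<P>(\<omega> in measure_pmf J. snd \<omega> = u) *
        \<P>(\<omega> in measure_pmf J. fst (fst \<omega>) = x \<bar> snd \<omega> = u) *
        \<P>(\<omega> in measure_pmf J. fst (snd (fst \<omega>)) = y \<bar> snd \<omega> = u) *
        \<P>(\<omega> in measure_pmf J. snd (snd (fst \<omega>)) = z \<bar> snd \<omega> = u))"

definition mutual_info :: "('a \<times> 'u) pmf \<Rightarrow> real" where
  "mutual_info J =
     prob_space.mutual_information (measure_pmf J) 2 (count_space UNIV) (count_space UNIV) fst snd"

end

theory Submission
  imports Defs
begin

text \<open>
  Both sides are described by mixtures $p = \sum_u P(u) V_u$ of product distributions $V_u$, and
  $I(X,Y,Z;U) = H(p) - \sum_u P(u) H(V_u)$.

  Achievability. If $I < R_0$, a codebook of $2^{n R_0}$ words $u^n$ whose averaged output is close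
  to $p^n$ is selected greedily, one codeword at a time: the potential to be
  kept small is a weighted sum of a squared $\chi^2$-deviation of the output restricted to typical pairs
  and of the atypical mass, and a second moment computation shows that some codeword increases it
  by at most 2. If
  $I = R_0 > 0$, moving weight to a $u$ with $D(V_u \| p) \le I$ strictly decreases $I$, so $p$ is a
  limit of achievable distributions; if $I = R_0 = 0$, $p$ itself is a product.

  Converse. For a code with output $\tilde p$ and $M$ values $\omega$ of the common randomness,
  $H(\tilde p) \le \ln M + \frac{1}{M} \sum_\omega \sum_i H(S_i \mid \omega)$, while $H(\tilde p)$ is
  at least about $n H(p)$. Hence some coordinate $i$ satisfies
  $\frac{1}{M} \sum_\omega H(S_i \mid \omega) \ge H(p) - R_0 - o(1)$, and given $\omega$ the letter $S_i$ has a
  product law. So a point near $(p, h)$ with $h \ge H(p) - R_0 - o(1)$ lies in the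
  convex hull of the compact set of pairs $(V, H(V))$, $V$ a product distribution; the limit is taken in this
  compact hull. Finally the number of points in the mixture is lowered to
  $|\mathcal X||\mathcal Y||\mathcal Z|$ by moving along linear dependencies without decreasing
  the average entropy.
\<close>

subsection \<open>Entropy of block distributions\<close>

text \<open>Entropy in nats, so rates enter below as \<open>R * ln 2\<close>. Terms of mass zero
  vanish through their first factor.\<close>

definition entf :: "'a set \<Rightarrow> ('a \<Rightarrow> real) \<Rightarrow> real" where
  "entf A f = - (\<Sum>a\<in>A. f a * ln (f a))"

text \<open>The inequality ln r \<le> r - 1 at r = y / x, multiplied by x. The implication is
  absolute continuity; for x = 0 what remains is 0 \<le> y.\<close>

lemma gibbs_term:
  fixes x y :: real
  assumes "0 \<le> x" "0 \<le> y" "x > 0 \<Longrightarrow> y > 0"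
  shows "x * ln y \<le> x * ln x + (y - x)"
proof (cases "x = 0")
  case False
  then have x: "x > 0" and y: "y > 0" using assms by auto
  have "ln (y / x) \<le> y / x - 1" using x y by (intro ln_le_minus_one) auto
  then have "x * ln (y / x) \<le> x * (y / x - 1)" using x by (intro mult_left_mono) auto
  moreover have "x * (y / x - 1) = y - x" using x by (simp add: field_simps)
  ultimately show ?thesis using x y by (simp add: ln_div right_diff_distrib)
qed (use assms in auto)

text \<open>Equality in ln r \<le> r - 1 holds only at r = 1.\<close>

lemma gibbs_term_strict:
  fixes x y :: real
  assumes "0 \<le> x" "0 \<le> y" "x > 0 \<Longrightarrow> y > 0" "x \<noteq> y"
  shows "x * ln y < x * ln x + (y - x)"
proof (cases "x = 0")
  case False
  then have x: "x > 0" and y: "y > 0" using assms by auto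
  have "ln (y / x) < y / x - 1"
    using ln_le_minus_one[of "y/x"] ln_eq_minus_one[of "y/x"] x y assms(4) by fastforce
  then have "x * ln (y / x) < x * (y / x - 1)" using x by (intro mult_strict_left_mono) auto
  moreover have "x * (y / x - 1) = y - x" using x by (simp add: field_simps)
  ultimately show ?thesis using x y by (simp add: ln_div right_diff_distrib)
qed (use assms in auto)

text \<open>The corrections \<open>g a - f a\<close> of \<open>gibbs_term\<close> add up to at most
  0, so \<open>g\<close> may be any nonnegative weight of total at most that of
  \<open>f\<close>.\<close>

lemma gibbs:
  fixes f g :: "'a \<Rightarrow> real"
  assumes "\<And>a. a \<in> A \<Longrightarrow> 0 \<le> f a" "\<And>a. a \<in> A \<Longrightarrow> 0 \<le> g a"
    "\<And>a. a \<in> A \<Longrightarrow> f a > 0 \<Longrightarrow> g a > 0" "sum g A \<le> sum f A"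
  shows "entf A f \<le> - (\<Sum>a\<in>A. f a * ln (g a))"
proof -
  have "(\<Sum>a\<in>A. f a * ln (g a)) \<le> (\<Sum>a\<in>A. f a * ln (f a) + (g a - f a))"
    using assms by (intro sum_mono gibbs_term) auto
  also have "\<dots> = (\<Sum>a\<in>A. f a * ln (f a)) + (sum g A - sum f A)"
    by (simp add: sum.distrib sum_subtractf)
  finally show ?thesis using assms(4) by (simp add: entf_def)
qed

lemma gibbs_strict:
  fixes f g :: "'a \<Rightarrow> real"
  assumes "finite A" "\<And>a. a \<in> A \<Longrightarrow> 0 \<le> f a" "\<And>a. a \<in> A \<Longrightarrow> 0 \<le> g a"
    "\<And>a. a \<in> A \<Longrightarrow> f a > 0 \<Longrightarrow> g a > 0" "sum g A \<le> sum f A" "b \<in> A" "f b \<noteq> g b"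
  shows "entf A f < - (\<Sum>a\<in>A. f a * ln (g a))"
proof -
  have "(\<Sum>a\<in>A. f a * ln (g a)) < (\<Sum>a\<in>A. f a * ln (f a) + (g a - f a))"
    using assms
    by (intro sum_strict_mono_strong[of _ b] gibbs_term_strict gibbs_term) auto
  also have "\<dots> = (\<Sum>a\<in>A. f a * ln (f a)) + (sum g A - sum f A)"
    by (simp add: sum.distrib sum_subtractf)
  finally show ?thesis using assms(5) by (simp add: entf_def)
qed

text \<open>If q \<le> p, this is Gibbs for (q, p) together with ln p \<le> 0. If q = p + b with b >
  0, then ln q is at least ln p and at least ln b, and - b ln b is bounded by Gibbs against 1 / N.
  With N the size of the alphabet the terms 1 / N add up to 1.\<close>

lemma entropy_term_diff:
  fixes p q N :: real
  assumes "0 \<le> p" "p \<le> 1" "0 \<le> q" "N > 0"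
  shows "- (q * ln q) \<le> - (p * ln p) + (p - q) + max 0 (q - p) * ln N + 1 / N"
proof (cases "q \<le> p")
  case True
  have "q * ln p \<le> q * ln q + (p - q)" using True assms by (intro gibbs_term) auto
  moreover have "p * ln p \<le> q * ln p"
    using True assms by (cases "p = 0") (auto intro: mult_right_mono_neg)
  moreover have "1 / N > 0" using assms by simp
  moreover have "max 0 (q - p) * ln N = 0" using True by simp
  ultimately show ?thesis by linarith
next
  case False
  define b where "b = q - p"
  have b: "b > 0" using False by (simp add: b_def)
  have "b * ln (1 / N) \<le> b * ln b + (1 / N - b)" using b assms by (intro gibbs_term) auto
  then have "- (b * ln b) \<le> b * ln N + 1 / N - b" using assms by (simp add: ln_div)
  moreover have "p * ln p \<le> p * ln q"
    using False assms by (cases "p = 0") (auto intro: mult_left_mono)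
  moreover have "b * ln b \<le> b * ln q" using b assms False
    by (intro mult_left_mono) (auto simp: b_def)
  moreover have "q * ln q = p * ln q + b * ln q" by (simp add: b_def algebra_simps)
  moreover have "max 0 (q - p) * ln N = b * ln N" using b by (simp add: b_def max_def)
  ultimately show ?thesis using b_def by linarith
qed

text \<open>The additive 1 is harmless because the bound is applied once to a whole block and then
  divided by the block length.\<close>

lemma entropy_tv_bound:
  fixes f g :: "'a \<Rightarrow> real"
  assumes "finite A" "A \<noteq> {}" "\<And>a. a \<in> A \<Longrightarrow> 0 \<le> f a" "\<And>a. a \<in> A \<Longrightarrow> 0 \<le> g a"
    "sum f A = 1" "sum g A = 1"
  shows "entf A g \<le> entf A f + tv_dist A f g * ln (card A) + 1"
proof -
  have c: "real (card A) > 0" using assms by (simp add: card_gt_0_iff)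
  have f1: "f a \<le> 1" if "a \<in> A" for a
    using member_le_sum[of a A f] that assms by auto
  have "entf A g = (\<Sum>a\<in>A. - (g a * ln (g a)))" by (simp add: entf_def sum_negf)
  also have "\<dots> \<le> (\<Sum>a\<in>A. - (f a * ln (f a)) + (f a - g a) + max 0 (g a - f a) * ln (card A) + 1 / card A)"
    using assms f1 c by (intro sum_mono entropy_term_diff) auto
  also have "\<dots> = entf A f + (\<Sum>a\<in>A. max 0 (g a - f a)) * ln (card A) + 1"
    using c assms by (simp add: entf_def sum.distrib sum_subtractf sum_negf sum_distrib_right)
  \<comment> \<open>As \<open>f\<close> and \<open>g\<close> have the same total, the positive part
    of \<open>g - f\<close> carries exactly half of the L1 distance.\<close>
  also have "(\<Sum>a\<in>A. max 0 (g a - f a)) = (\<Sum>a\<in>A. 1/2 * (\<bar>f a - g a\<bar> + (g a - f a)))"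
    by (intro sum.cong) (auto simp: max_def abs_if)
  also have "\<dots> = tv_dist A f g"
    using assms by (simp add: tv_dist_def sum.distrib sum_subtractf flip: sum_distrib_left sum_divide_distrib)
  finally show ?thesis .
qed

section \<open>Blocks as words over the product alphabet\<close>

definition letter :: "nat \<Rightarrow> 'x list \<times> 'y list \<times> 'z list \<Rightarrow> 'x \<times> 'y \<times> 'z" where
  "letter i = (\<lambda>(xs, ys, zs). (xs ! i, ys ! i, zs ! i))"

lemma iid_mass_letter: "iid_mass p n a = (\<Prod>i<n. pmf p (letter i a))"
  by (cases a) (simp add: iid_mass_def letter_def)

text \<open>Carries sums over blocks to sums over \<open>PiE\<close>, where products of sums expand.
  The \<open>restrict\<close> gives the value \<open>undefined\<close> outside
  \<open>{..<n}\<close>, as membership in \<open>PiE\<close> demands.\<close>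

lemma bij_betw_blocks:
  "bij_betw (\<lambda>a. restrict (\<lambda>i. letter i a) {..<n}) (blocks n) (PiE {..<n} (\<lambda>_. UNIV :: ('x \<times> 'y \<times> 'z) set))"
proof (rule bij_betwI[where g = "\<lambda>h. (map (\<lambda>i. fst (h i)) [0..<n], map (\<lambda>i. fst (snd (h i))) [0..<n], map (\<lambda>i. snd (snd (h i))) [0..<n])"], goal_cases)
  case (3 a)
  then show ?case by (auto simp: blocks_def letter_def intro!: nth_equalityI)
next
  case (4 h)
  then show ?case by (auto simp: letter_def fun_eq_iff PiE_def extensional_def)
qed (auto simp: blocks_def)

text \<open>Distributivity of products over sums. Sums of memoryless expressions over blocks are
  reduced to single letters through it.\<close>

lemma sum_blocks_prod:
  fixes g :: "nat \<Rightarrow> ('x::finite \<times> 'y::finite \<times> 'z::finite) \<Rightarrow> real"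
  shows "(\<Sum>a\<in>blocks n. \<Prod>i<n. g i (letter i a)) = (\<Prod>i<n. \<Sum>s\<in>UNIV. g i s)"
proof -
  have "(\<Sum>a\<in>blocks n. \<Prod>i<n. g i (letter i a)) =
     (\<Sum>a\<in>blocks n. \<Prod>i<n. g i (restrict (\<lambda>i. letter i a) {..<n} i))"
    by (intro sum.cong prod.cong) auto
  also have "\<dots> = (\<Sum>h\<in>PiE {..<n} (\<lambda>_. UNIV). \<Prod>i<n. g i (h i))"
    by (rule sum.reindex_bij_betw[OF bij_betw_blocks, of "\<lambda>h. \<Prod>i<n. g i (h i)"])
  also have "\<dots> = (\<Prod>i<n. \<Sum>s\<in>UNIV. g i s)"
    by (simp add: prod_sum_PiE)
  finally show ?thesis .
qed

lemma finite_blocks [simp]: "finite (blocks n :: ('x::finite list \<times> 'y::finite list \<times> 'z::finite list) set)"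
  using bij_betw_finite[OF bij_betw_blocks[of n]] by (auto intro: finite_PiE)

lemma card_blocks: "card (blocks n :: ('x::finite list \<times> 'y::finite list \<times> 'z::finite list) set) = CARD('x \<times> 'y \<times> 'z) ^ n"
  using bij_betw_same_card[OF bij_betw_blocks[of n]] by (auto simp: card_PiE)

lemma blocks_nonempty: "(blocks n :: ('x list \<times> 'y list \<times> 'z list) set) \<noteq> {}"
proof -
  have "(replicate n undefined, replicate n undefined, replicate n undefined) \<in> blocks n"
    by (simp add: blocks_def)
  then show ?thesis by blast
qed

text \<open>Attach the factor \<phi> to coordinate i and the factor 1 to the others; the other
  coordinates then sum to 1.\<close>

lemma sum_blocks_iid_letter:
  fixes p :: "('x::finite \<times> 'y::finite \<times> 'z::finite) pmf"
  assumes "i < n"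
  shows "(\<Sum>a\<in>blocks n. iid_mass p n a * \<phi> (letter i a)) = (\<Sum>s\<in>UNIV. pmf p s * \<phi> s)"
proof -
  have "iid_mass p n a * \<phi> (letter i a) = (\<Prod>j<n. pmf p (letter j a) * (if j = i then \<phi> (letter j a) else 1))" for a
    using assms by (simp add: iid_mass_letter prod.distrib)
  then have "(\<Sum>a\<in>blocks n. iid_mass p n a * \<phi> (letter i a)) =
     (\<Prod>j<n. \<Sum>s\<in>UNIV. pmf p s * (if j = i then \<phi> s else 1))"
    by (simp add: sum_blocks_prod[where g = "\<lambda>j s. pmf p s * (if j = i then \<phi> s else 1)"] del: prod.distrib)
  also have "\<dots> = (\<Prod>j<n. if j = i then \<Sum>s\<in>UNIV. pmf p s * \<phi> s else 1)"
    by (intro prod.cong) (auto simp: sum_pmf_eq_1)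
  finally show ?thesis using assms by simp
qed

lemma sum_iid_mass:
  fixes p :: "('x::finite \<times> 'y::finite \<times> 'z::finite) pmf"
  shows "(\<Sum>a\<in>blocks n. iid_mass p n a) = 1"
  by (simp add: iid_mass_letter sum_blocks_prod[where g = "\<lambda>_. pmf p"] sum_pmf_eq_1)

lemma iid_mass_nonneg: "0 \<le> iid_mass p n a"
  by (simp add: iid_mass_letter prod_nonneg)

text \<open>The logarithm of the product splits into a sum, and each summand depends on one letter
  only. On blocks of mass zero both sides of the splitting are 0.\<close>

lemma entf_iid:
  fixes p :: "('x::finite \<times> 'y::finite \<times> 'z::finite) pmf"
  shows "entf (blocks n) (iid_mass p n) = n * entf UNIV (pmf p)"
proof -
  have "iid_mass p n a * ln (iid_mass p n a) = (\<Sum>i<n. iid_mass p n a * ln (pmf p (letter i a)))" for a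
  proof (cases "\<forall>i<n. pmf p (letter i a) > 0")
    case True
    then have "ln (iid_mass p n a) = (\<Sum>i<n. ln (pmf p (letter i a)))"
      unfolding iid_mass_letter by (intro ln_prod) auto
    then show ?thesis by (simp add: sum_distrib_left)
  next
    case False
    then have "iid_mass p n a = 0" by (force simp: iid_mass_letter pmf_positive_iff set_pmf_iff)
    then show ?thesis by simp
  qed
  then have "(\<Sum>a\<in>blocks n. iid_mass p n a * ln (iid_mass p n a)) =
      (\<Sum>a\<in>blocks n. \<Sum>i<n. iid_mass p n a * ln (pmf p (letter i a)))"
    by simp
  also have "\<dots> = (\<Sum>i<n. \<Sum>a\<in>blocks n. iid_mass p n a * ln (pmf p (letter i a)))"
    by (rule sum.swap)
  also have "\<dots> = (\<Sum>i<n. \<Sum>s\<in>UNIV. pmf p s * ln (pmf p s))"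
    by (intro sum.cong refl sum_blocks_iid_letter[where \<phi> = "\<lambda>s. ln (pmf p s)"]) auto
  finally show ?thesis by (simp add: entf_def)
qed

text \<open>Stands in for a random choice: it selects the next codeword in
  \<open>soft_covering\<close> and a component of small divergence from the mixture in
  \<open>mixture_info_eq_0\<close> and \<open>mixture_perturbation\<close>.\<close>

lemma exists_le_weighted_mean:
  fixes \<mu> \<phi> :: "'c \<Rightarrow> real"
  assumes "finite C" "\<And>c. c \<in> C \<Longrightarrow> 0 < \<mu> c" "sum \<mu> C = 1" "(\<Sum>c\<in>C. \<mu> c * \<phi> c) \<le> B"
  shows "\<exists>c\<in>C. \<phi> c \<le> B"
proof (rule ccontr)
  assume "\<not> ?thesis"
  then have gt: "\<And>c. c \<in> C \<Longrightarrow> B < \<phi> c" by auto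
  have "C \<noteq> {}" using assms(3) by auto
  then have "(\<Sum>c\<in>C. \<mu> c * B) < (\<Sum>c\<in>C. \<mu> c * \<phi> c)"
    using assms gt by (intro sum_strict_mono) auto
  then show False using assms by (simp flip: sum_distrib_right)
qed

subsection \<open>Soft covering\<close>

text \<open>One-shot covering: \<open>\<mu>\<close> is the law of a codeword, \<open>P c\<close> its
  output, \<open>K\<close> a cutoff for the likelihood ratio \<open>P c a / Q a\<close>. The term
  sqrt (2 K / M) bounds the fluctuation of the truncated outputs. Of the 3 \<delta>, two parts are
  mass that the chosen codewords lose by truncation and one is the mass that \<open>Q\<close>
  loses.\<close>

lemma soft_covering:
  fixes C :: "'c set" and \<mu> :: "'c \<Rightarrow> real" and P :: "'c \<Rightarrow> 'a \<Rightarrow> real" and K \<delta> :: real and M :: nat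
  defines "Q \<equiv> \<lambda>a. \<Sum>c\<in>C. \<mu> c * P c a"
  assumes fin: "finite C" "finite X" and \<mu>: "\<And>c. c \<in> C \<Longrightarrow> 0 < \<mu> c" "sum \<mu> C = 1"
    and P: "\<And>c a. 0 \<le> P c a" and Q: "sum Q X = 1"
    and K: "K > 0" and \<delta>: "\<delta> > 0" and M: "M \<ge> 1"
    and tail: "(\<Sum>c\<in>C. \<mu> c * (\<Sum>a\<in>X. if P c a \<le> K * Q a then 0 else P c a)) \<le> \<delta>"
  shows "\<exists>f :: nat \<Rightarrow> 'c. (\<forall>i. f i \<in> C) \<and>
    (\<Sum>a\<in>X. \<bar>(\<Sum>i<M. P (f i) a) / M - Q a\<bar>) \<le> sqrt (2 * K / M) + 3 * \<delta>"
proof -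
  \<comment> \<open>Truncated output, its mean, the centred deviation of a codeword from that mean,
    and the mass that the codeword loses.\<close>
  define P1 where "P1 = (\<lambda>c a. if P c a \<le> K * Q a then P c a else 0)"
  define Q1 where "Q1 = (\<lambda>a. \<Sum>c\<in>C. \<mu> c * P1 c a)"
  define g where "g = (\<lambda>c a. P1 c a - Q1 a)"
  define h where "h = (\<lambda>c. \<Sum>a\<in>X. P c a - P1 c a)"
  have P1: "0 \<le> P1 c a" "P1 c a \<le> P c a" "P1 c a \<le> K * Q a" if "c \<in> C" for c a
  proof -
    have "0 \<le> Q a" using P less_imp_le[OF \<mu>(1)] by (auto simp: Q_def intro!: sum_nonneg mult_nonneg_nonneg)
    then show "0 \<le> P1 c a" "P1 c a \<le> P c a" "P1 c a \<le> K * Q a" using P K by (auto simp: P1_def)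
  qed
  have Q0: "0 \<le> Q a" for a
    using P less_imp_le[OF \<mu>(1)] by (auto simp: Q_def intro!: sum_nonneg mult_nonneg_nonneg)
  have Q1: "0 \<le> Q1 a" "Q1 a \<le> Q a" for a
    using P1 less_imp_le[OF \<mu>(1)]
    by (auto simp: Q_def Q1_def intro!: sum_nonneg sum_mono mult_nonneg_nonneg mult_left_mono)
  have h0: "0 \<le> h c" if "c \<in> C" for c using P1[OF that] by (auto simp: h_def intro!: sum_nonneg)
  have mean_g: "(\<Sum>c\<in>C. \<mu> c * g c a) = 0" for a
    using \<mu>(2) by (simp add: g_def right_diff_distrib sum_subtractf Q1_def flip: sum_distrib_right)
  have mean_h: "(\<Sum>c\<in>C. \<mu> c * h c) \<le> \<delta>"
  proof -
    have "h c = (\<Sum>a\<in>X. if P c a \<le> K * Q a then 0 else P c a)" for c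
      unfolding h_def P1_def by (intro sum.cong) auto
    then show ?thesis using tail by simp
  qed
  \<comment> \<open>The variance is at most the second moment, and one of the two factors
    \<open>P1\<close> is replaced by its bound \<open>K * Q a\<close>.\<close>
  have var_g: "(\<Sum>c\<in>C. \<mu> c * (g c a)\<^sup>2) \<le> K * (Q a)\<^sup>2" for a
  proof -
    have "(\<Sum>c\<in>C. \<mu> c * (g c a)\<^sup>2) =
       (\<Sum>c\<in>C. \<mu> c * (P1 c a)\<^sup>2 - 2 * Q1 a * (\<mu> c * P1 c a) + (Q1 a)\<^sup>2 * \<mu> c)"
      by (intro sum.cong refl) (simp add: g_def power2_eq_square algebra_simps)
    also have "\<dots> = (\<Sum>c\<in>C. \<mu> c * (P1 c a)\<^sup>2) - (Q1 a)\<^sup>2"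
      using \<mu>(2) by (simp add: sum.distrib sum_subtractf Q1_def power2_eq_square flip: sum_distrib_left)
    also have "\<dots> \<le> (\<Sum>c\<in>C. \<mu> c * (P1 c a)\<^sup>2)" by simp
    also have "\<dots> \<le> (\<Sum>c\<in>C. \<mu> c * ((K * Q a) * P1 c a))"
      using P1 less_imp_le[OF \<mu>(1)]
      by (intro sum_mono mult_left_mono) (auto simp: power2_eq_square intro!: mult_right_mono)
    also have "\<dots> = K * Q a * Q1 a" by (simp add: Q1_def sum_distrib_left algebra_simps)
    also have "\<dots> \<le> K * Q a * Q a" using Q1 Q0 K by (intro mult_left_mono) auto
    finally show ?thesis by (simp add: power2_eq_square algebra_simps)
  qed
  \<comment> \<open>Where \<open>Q a = 0\<close> the quotients below are 0 by convention; nothing is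
    lost, because the deviations vanish there too.\<close>
  have zero_g: "g c a = 0" if "Q a = 0" "c \<in> C" for c a
  proof -
    have "P1 c a = 0" using P1[OF that(2), of a] that by simp
    moreover have "Q1 a = 0" using Q1[of a] that by simp
    ultimately show ?thesis by (simp add: g_def)
  qed
  \<comment> \<open>In the step, the cross term of the square averages to 0 over \<open>C\<close> because \<open>g\<close> has mean 0.\<close>
  have greedy: "\<exists>f :: nat \<Rightarrow> 'c. (\<forall>i. f i \<in> C) \<and>
      (\<Sum>a\<in>X. (\<Sum>i<m. g (f i) a)\<^sup>2 / Q a) / K + (\<Sum>i<m. h (f i)) / \<delta> \<le> 2 * real m" for m
  proof (induction m)
    case 0
    \<comment> \<open>Codebooks are total functions, so even the empty one needs some element of
      \<open>C\<close> as a filler.\<close>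
    have "C \<noteq> {}" using \<mu>(2) by auto
    then show ?case by (auto intro!: exI[of _ "\<lambda>_. SOME c. c \<in> C"] some_in_eq[THEN iffD2])
  next
    case (Suc m)
    then obtain f where f: "\<And>i. f i \<in> C"
      "(\<Sum>a\<in>X. (\<Sum>i<m. g (f i) a)\<^sup>2 / Q a) / K + (\<Sum>i<m. h (f i)) / \<delta> \<le> 2 * real m" by blast
    define S where "S = (\<lambda>a. \<Sum>i<m. g (f i) a)"
    \<comment> \<open>The increase of the potential when \<open>c\<close> is appended. In the mean
      the cross term contributes 0, the square at most 1 and the lost mass at most 1.\<close>
    define \<phi> where "\<phi> = (\<lambda>c. (\<Sum>a\<in>X. 2 * S a / Q a * g c a) / K + (\<Sum>a\<in>X. (g c a)\<^sup>2 / Q a) / K + h c / \<delta>)"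
    have "(\<Sum>c\<in>C. \<mu> c * \<phi> c) = (\<Sum>c\<in>C. \<Sum>a\<in>X. 2 * S a / Q a * (\<mu> c * g c a)) / K
        + (\<Sum>c\<in>C. \<Sum>a\<in>X. \<mu> c * (g c a)\<^sup>2 / Q a) / K + (\<Sum>c\<in>C. \<mu> c * h c) / \<delta>"
      by (simp add: \<phi>_def distrib_left sum.distrib sum_distrib_left sum_divide_distrib ac_simps)
    also have "(\<Sum>c\<in>C. \<Sum>a\<in>X. 2 * S a / Q a * (\<mu> c * g c a)) = (\<Sum>a\<in>X. 2 * S a / Q a * (\<Sum>c\<in>C. \<mu> c * g c a))"
      by (subst sum.swap) (simp add: sum_distrib_left)
    also have "(\<Sum>c\<in>C. \<Sum>a\<in>X. \<mu> c * (g c a)\<^sup>2 / Q a) = (\<Sum>a\<in>X. (\<Sum>c\<in>C. \<mu> c * (g c a)\<^sup>2) / Q a)"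
      by (subst sum.swap) (simp add: sum_divide_distrib)
    also have "(\<Sum>a\<in>X. 2 * S a / Q a * (\<Sum>c\<in>C. \<mu> c * g c a)) / K
        + (\<Sum>a\<in>X. (\<Sum>c\<in>C. \<mu> c * (g c a)\<^sup>2) / Q a) / K + (\<Sum>c\<in>C. \<mu> c * h c) / \<delta>
      \<le> 0 + K / K + \<delta> / \<delta>"
    proof (intro add_mono divide_right_mono mean_h)
      have "(\<Sum>a\<in>X. (\<Sum>c\<in>C. \<mu> c * (g c a)\<^sup>2) / Q a) \<le> (\<Sum>a\<in>X. K * (Q a)\<^sup>2 / Q a)"
        using Q0 var_g by (intro sum_mono divide_right_mono) auto
      also have "\<dots> = (\<Sum>a\<in>X. K * Q a)" by (intro sum.cong) (auto simp: power2_eq_square)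
      also have "\<dots> = K" using Q by (simp flip: sum_distrib_left)
      finally show "(\<Sum>a\<in>X. (\<Sum>c\<in>C. \<mu> c * (g c a)\<^sup>2) / Q a) \<le> K" .
    qed (use K \<delta> in \<open>auto simp: mean_g\<close>)
    finally have "(\<Sum>c\<in>C. \<mu> c * \<phi> c) \<le> 2" using K \<delta> by simp
    then obtain c where c: "c \<in> C" "\<phi> c \<le> 2"
      using exists_le_weighted_mean[of C \<mu> \<phi> 2] fin \<mu> by auto
    have "(\<Sum>a\<in>X. (S a + g c a)\<^sup>2 / Q a) =
       (\<Sum>a\<in>X. (S a)\<^sup>2 / Q a + 2 * S a / Q a * g c a + (g c a)\<^sup>2 / Q a)"
      by (intro sum.cong refl) (simp add: power2_sum add_divide_distrib)
    then have "(\<Sum>a\<in>X. (S a + g c a)\<^sup>2 / Q a) / K + ((\<Sum>i<m. h (f i)) + h c) / \<delta>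
       = (\<Sum>a\<in>X. (S a)\<^sup>2 / Q a) / K + (\<Sum>i<m. h (f i)) / \<delta> + \<phi> c"
      by (simp add: \<phi>_def sum.distrib add_divide_distrib)
    also have "\<dots> \<le> 2 * real (Suc m)" using f(2) c(2) by (simp add: S_def)
    finally have "(\<Sum>a\<in>X. (\<Sum>i<Suc m. g ((f(m := c)) i) a)\<^sup>2 / Q a) / K + (\<Sum>i<Suc m. h ((f(m := c)) i)) / \<delta>
        \<le> 2 * real (Suc m)"
      by (simp add: S_def)
    moreover have "\<forall>i. (f(m := c)) i \<in> C" using f c by auto
    ultimately show ?case by blast
  qed
  obtain f where f: "\<And>i. f i \<in> C"
    and pot: "(\<Sum>a\<in>X. (\<Sum>i<M. g (f i) a)\<^sup>2 / Q a) / K + (\<Sum>i<M. h (f i)) / \<delta> \<le> 2 * real M"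
    using greedy by blast
  define S where "S = (\<lambda>a. \<Sum>i<M. g (f i) a)"
  \<comment> \<open>Both parts of the potential are nonnegative, so each of them alone is at most 2
    M.\<close>
  have nn: "0 \<le> (\<Sum>a\<in>X. (S a)\<^sup>2 / Q a) / K" "0 \<le> (\<Sum>i<M. h (f i)) / \<delta>"
    using Q0 K \<delta> h0 f by (auto intro!: sum_nonneg divide_nonneg_nonneg)
  have F: "(\<Sum>a\<in>X. (S a)\<^sup>2 / Q a) \<le> 2 * M * K"
  proof -
    have "(\<Sum>a\<in>X. (S a)\<^sup>2 / Q a) / K \<le> 2 * real M" using pot nn unfolding S_def by linarith
    then show ?thesis using K by (simp add: pos_divide_le_eq)
  qed
  have H: "(\<Sum>i<M. h (f i)) \<le> 2 * M * \<delta>"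
  proof -
    have "(\<Sum>i<M. h (f i)) / \<delta> \<le> 2 * real M" using pot nn unfolding S_def by linarith
    then show ?thesis using \<delta> by (simp add: pos_divide_le_eq)
  qed
  \<comment> \<open>Cauchy-Schwarz with weights \<open>sqrt (Q a)\<close>: since \<open>Q\<close>
    has total mass 1, the squared L1 norm is at most the chi-square sum in the potential.\<close>
  have "(\<Sum>a\<in>X. \<bar>S a\<bar>)\<^sup>2 = (\<Sum>a\<in>X. sqrt (Q a) * (\<bar>S a\<bar> / sqrt (Q a)))\<^sup>2"
    using zero_g f by (intro arg_cong[where f = "\<lambda>x. x\<^sup>2"] sum.cong) (auto simp: S_def)
  also have "\<dots> \<le> (\<Sum>a\<in>X. (sqrt (Q a))\<^sup>2) * (\<Sum>a\<in>X. (\<bar>S a\<bar> / sqrt (Q a))\<^sup>2)"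
    by (rule Cauchy_Schwarz_ineq_sum)
  also have "\<dots> = (\<Sum>a\<in>X. (S a)\<^sup>2 / Q a)" using Q Q0 by (simp add: power_divide)
  finally have "(\<Sum>a\<in>X. \<bar>S a\<bar>) \<le> sqrt (2 * M * K)"
    using F by (intro real_le_rsqrt) auto
  moreover have "sqrt (2 * M * K) = M * sqrt (2 * K / M)"
  proof -
    have "2 * M * K = (real M)\<^sup>2 * (2 * K / M)" using M by (simp add: power2_eq_square)
    then have "sqrt (2 * M * K) = sqrt ((real M)\<^sup>2 * (2 * K / M))" by (rule arg_cong)
    also have "\<dots> = sqrt ((real M)\<^sup>2) * sqrt (2 * K / M)" by (rule real_sqrt_mult)
    finally show ?thesis by simp
  qed
  ultimately have Sb: "(\<Sum>a\<in>X. \<bar>S a\<bar>) / M \<le> sqrt (2 * K / M)" using M by (simp add: field_simps)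
  have "(\<Sum>a\<in>X. \<bar>(\<Sum>i<M. P (f i) a) / M - Q a\<bar>) \<le>
     (\<Sum>a\<in>X. \<bar>S a\<bar> / M + (\<Sum>i<M. P (f i) a - P1 (f i) a) / M + (Q a - Q1 a))"
  proof (intro sum_mono)
    fix a
    have "(\<Sum>i<M. P (f i) a) / M - Q a = S a / M + (\<Sum>i<M. P (f i) a - P1 (f i) a) / M - (Q a - Q1 a)"
      using M by (simp add: S_def g_def sum_subtractf diff_divide_distrib)
    moreover have "0 \<le> (\<Sum>i<M. P (f i) a - P1 (f i) a) / M"
      using P1 f by (auto intro!: sum_nonneg divide_nonneg_nonneg)
    moreover have "\<bar>S a / M\<bar> = \<bar>S a\<bar> / M" by simp
    ultimately show "\<bar>(\<Sum>i<M. P (f i) a) / M - Q a\<bar> \<le>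
       \<bar>S a\<bar> / M + (\<Sum>i<M. P (f i) a - P1 (f i) a) / M + (Q a - Q1 a)"
      using Q1[of a] by linarith
  qed
  also have "\<dots> = (\<Sum>a\<in>X. \<bar>S a\<bar>) / M + (\<Sum>i<M. h (f i)) / M + (\<Sum>a\<in>X. Q a - Q1 a)"
    unfolding h_def by (subst sum.swap) (simp add: sum.distrib sum_divide_distrib)
  also have "(\<Sum>a\<in>X. Q a - Q1 a) = (\<Sum>c\<in>C. \<mu> c * h c)"
    unfolding h_def Q_def Q1_def
    by (subst sum_distrib_left, subst sum.swap) (simp add: sum_subtractf right_diff_distrib)
  also have "(\<Sum>i<M. h (f i)) / M \<le> 2 * \<delta>" using H M by (simp add: field_simps)
  finally show ?thesis using Sb mean_h f by (intro exI[of _ f]) auto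
qed

text \<open>As a function of t the expression equals 1 at 0 and has there the derivative (mean of
  \<open>l\<close>) - \<kappa> < 0, so it falls below 1 just to the right of 0.\<close>

lemma chernoff_exponent:
  fixes w l :: "'i \<Rightarrow> real"
  assumes "finite J" "sum w J = 1" "(\<Sum>j\<in>J. w j * l j) < \<kappa>"
  shows "\<exists>t>0. exp (- t * \<kappa>) * (\<Sum>j\<in>J. w j * exp (t * l j)) < 1"
proof -
  define \<psi> where "\<psi> = (\<lambda>t::real. exp (- t * \<kappa>) * (\<Sum>j\<in>J. w j * exp (t * l j)))"
  have "(\<psi> has_real_derivative ((\<Sum>j\<in>J. w j * l j) - \<kappa>)) (at 0)"
    unfolding \<psi>_def using assms(2) by (auto intro!: derivative_eq_intros simp: algebra_simps)
  from DERIV_neg_dec_right[OF this] assms(3)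
  obtain d where d: "d > 0" "\<And>h. 0 < h \<Longrightarrow> h < d \<Longrightarrow> \<psi> (0 + h) < \<psi> 0"
    by auto
  have "\<psi> 0 = 1" using assms by (simp add: \<psi>_def)
  then show ?thesis using d(2)[of "d/2"] d(1) by (intro exI[of _ "d/2"]) (auto simp: \<psi>_def)
qed

text \<open>Makes the measure-theoretic definition a finite sum. The type \<open>nat\<close> of the
  auxiliary variable is infinite, so the integral over the counting measure is cut down to
  \<open>UNIV \<times> U\<close>, outside of which \<open>J\<close> vanishes.\<close>

lemma mutual_info_eq:
  fixes J :: "('a::finite \<times> nat) pmf"
  assumes U: "finite U" "\<And>s u. (s, u) \<in> set_pmf J \<Longrightarrow> u \<in> U"
  shows "mutual_info J = (\<Sum>s\<in>UNIV. \<Sum>u\<in>U. pmf J (s, u) *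
     log 2 (pmf J (s, u) / (pmf (map_pmf fst J) s * pmf (map_pmf snd J) u)))"
proof -
  interpret information_space "measure_pmf J" 2
    by standard auto
  have D: "distributed (measure_pmf J) (count_space UNIV) X (\<lambda>x. ennreal (pmf (map_pmf X J) x))"
    for X :: "'a \<times> nat \<Rightarrow> 'b"
    unfolding distributed_def
    by (simp add: measure_pmf_eq_density[symmetric] map_pmf_rep_eq[symmetric])
  have cs: "count_space (UNIV :: 'a set) \<Otimes>\<^sub>M count_space (UNIV :: nat set) = count_space UNIV"
    by (simp add: pair_measure_countable)
  let ?f = "\<lambda>x. pmf J x * log 2 (pmf J x / (pmf (map_pmf fst J) (fst x) * pmf (map_pmf snd J) (snd x)))"
  have sub: "{x \<in> UNIV. ?f x \<noteq> 0} \<subseteq> UNIV \<times> U"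
    using U(2) by (auto simp: set_pmf_iff)
  have fin: "finite {x \<in> UNIV. ?f x \<noteq> 0}"
    using U(1) by (intro finite_subset[OF sub]) simp
  have "mutual_info J = (\<integral>x. pmf J x *
     log 2 (pmf J x / (pmf (map_pmf fst J) (fst x) * pmf (map_pmf snd J) (snd x))) \<partial>(count_space (UNIV :: 'a set) \<Otimes>\<^sub>M count_space (UNIV :: nat set)))"
    unfolding mutual_info_def
    using D[of "\<lambda>x. x"]
    by (intro mutual_information_distr D sigma_finite_measure_count_space_countable)
       (auto simp: cs)
  also have "\<dots> = (\<integral>x. pmf J x *
     log 2 (pmf J x / (pmf (map_pmf fst J) (fst x) * pmf (map_pmf snd J) (snd x))) \<partial>count_space UNIV)"
    by (simp add: cs)
  also have "\<dots> = (\<Sum>x\<in>UNIV \<times> U. pmf J x *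
     log 2 (pmf J x / (pmf (map_pmf fst J) (fst x) * pmf (map_pmf snd J) (snd x))))"
    unfolding lebesgue_integral_count_space_finite_support[OF fin]
    using sub U by (intro sum.mono_neutral_left) auto
  finally show ?thesis by (simp add: sum.cartesian_product split_def)
qed

subsection \<open>Block codes\<close>

lemma common_randomness_eq: "common_randomness R n = {1..nat \<lfloor>2 powr (real n * R)\<rfloor>}"
proof -
  have "real k \<le> x \<longleftrightarrow> k \<le> nat \<lfloor>x\<rfloor>" if "1 \<le> k" for k :: nat and x :: real
  proof -
    have "k \<le> nat \<lfloor>x\<rfloor> \<longleftrightarrow> int k \<le> \<lfloor>x\<rfloor>" using that by linarith
    then show ?thesis by (simp add: le_floor_iff)
  qed
  then show ?thesis by (auto simp: common_randomness_def)
qed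

lemma finite_common_randomness [simp]: "finite (common_randomness R n)"
  by (simp add: common_randomness_eq)

lemma common_randomness_nonempty: "R \<ge> 0 \<Longrightarrow> common_randomness R n \<noteq> {}"
proof -
  assume "R \<ge> 0"
  then have "1 \<in> common_randomness R n" by (simp add: common_randomness_def ge_one_powr_ge_zero)
  then show ?thesis by blast
qed

text \<open>Rounding a number that is at least 1 down to an integer costs at most a factor 2, which
  is harmless against exponential decay.\<close>

lemma card_common_randomness_bounds:
  assumes "R \<ge> 0"
  shows "real (card (common_randomness R n)) \<le> 2 powr (real n * R)"
    "2 powr (real n * R) / 2 \<le> real (card (common_randomness R n))" "card (common_randomness R n) \<ge> 1"
proof -
  define x where "x = (2::real) powr (real n * R)"
  have x: "x \<ge> 1" using assms by (simp add: x_def ge_one_powr_ge_zero)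
  have c: "card (common_randomness R n) = nat \<lfloor>x\<rfloor>" by (simp add: common_randomness_eq x_def)
  have "\<lfloor>x\<rfloor> \<ge> 1" using x by simp
  then have e: "real (nat \<lfloor>x\<rfloor>) = of_int \<lfloor>x\<rfloor>" "nat \<lfloor>x\<rfloor> \<ge> 1" by linarith+
  have "of_int \<lfloor>x\<rfloor> \<le> x" "x < of_int \<lfloor>x\<rfloor> + 1" by linarith+
  moreover have "real_of_int \<lfloor>x\<rfloor> \<ge> 1" using \<open>\<lfloor>x\<rfloor> \<ge> 1\<close> by linarith
  ultimately show "real (card (common_randomness R n)) \<le> 2 powr (real n * R)"
    "2 powr (real n * R) / 2 \<le> real (card (common_randomness R n))" "card (common_randomness R n) \<ge> 1"
    unfolding c x_def[symmetric] using e by linarith+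
qed

text \<open>Independent letters, letter i with law \<open>g i\<close>. \<open>Pi_pmf\<close> yields
  functions that are \<open>undefined\<close> from \<open>n\<close> on; only their first
  \<open>n\<close> values are listed.\<close>

definition block_pmf :: "nat \<Rightarrow> (nat \<Rightarrow> 'a pmf) \<Rightarrow> 'a list pmf" where
  "block_pmf n g = map_pmf (\<lambda>h. map h [0..<n]) (Pi_pmf {..<n} undefined g)"

lemma length_block_pmf: "xs \<in> set_pmf (block_pmf n g) \<Longrightarrow> length xs = n"
  by (auto simp: block_pmf_def)

lemma is_decoder_block_pmf: "is_decoder R n (\<lambda>\<omega>. block_pmf n (g \<omega>))"
  by (auto simp: is_decoder_def dest: length_block_pmf)

text \<open>A function in the support of \<open>Pi_pmf\<close> is determined by its values below
  \<open>n\<close>, so the preimage of \<open>xs\<close> meets the support in no point other than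
  \<open>h0\<close>.\<close>

lemma pmf_block_pmf:
  assumes "length xs = n"
  shows "pmf (block_pmf n g) xs = (\<Prod>i<n. pmf (g i) (xs ! i))"
proof -
  define h0 where "h0 = (\<lambda>i. if i < n then xs ! i else undefined)"
  have "map h0 [0..<n] = xs" using assms by (intro nth_equalityI) (simp_all add: h0_def)
  moreover have "h = h0" if h: "h \<in> set_pmf (Pi_pmf {..<n} undefined g)" "map h [0..<n] = xs" for h
  proof
    fix i
    show "h i = h0 i"
    proof (cases "i < n")
      case True
      then show ?thesis using h(2) by (auto simp: h0_def)
    next
      case False
      then show ?thesis using set_Pi_pmf_subset[of "{..<n}" undefined g] h(1) by (auto simp: h0_def)
    qed
  qed
  ultimately have "(\<lambda>h. map h [0..<n]) -` {xs} \<inter> set_pmf (Pi_pmf {..<n} undefined g) = {h0} \<inter> set_pmf (Pi_pmf {..<n} undefined g)"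
    by auto
  then have "measure (Pi_pmf {..<n} undefined g) ((\<lambda>h. map h [0..<n]) -` {xs}) = measure (Pi_pmf {..<n} undefined g) {h0}"
    by (metis measure_Int_set_pmf)
  then show ?thesis
    by (simp add: block_pmf_def pmf_map measure_pmf_single pmf_Pi h0_def)
qed

text \<open>The code looks up the word \<open>f \<omega>\<close> and each node passes its letters
  through its own channel \<open>A\<close>, \<open>B\<close> or \<open>C\<close>. The output is then
  the codebook average of memoryless laws.\<close>

lemma pmf_induced_block:
  fixes A :: "nat \<Rightarrow> 'x pmf" and B :: "nat \<Rightarrow> 'y pmf" and C :: "nat \<Rightarrow> 'z pmf"
  assumes "R \<ge> 0" "a \<in> blocks n"
  shows "pmf (induced_pmf R n (\<lambda>\<omega>. block_pmf n (\<lambda>i. A (f \<omega> i))) (\<lambda>\<omega>. block_pmf n (\<lambda>i. B (f \<omega> i)))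
       (\<lambda>\<omega>. block_pmf n (\<lambda>i. C (f \<omega> i)))) a =
     (\<Sum>\<omega>\<in>common_randomness R n. \<Prod>i<n. pmf (pair_pmf (A (f \<omega> i)) (pair_pmf (B (f \<omega> i)) (C (f \<omega> i)))) (letter i a))
       / card (common_randomness R n)"
proof -
  obtain xs ys zs where a: "a = (xs, ys, zs)" by (cases a)
  with assms have "length xs = n" "length ys = n" "length zs = n" by (auto simp: blocks_def)
  then show ?thesis
    unfolding induced_pmf_def using assms common_randomness_nonempty
    by (simp add: pmf_bind_pmf_of_set a pmf_pair pmf_block_pmf letter_def prod.distrib)
qed

section \<open>Achievability with strict inequality\<close>

text \<open>Decoders that ignore \<omega> produce the product law exactly. This settles the case of
  zero information, in which the rate may be 0 as well.\<close>

lemma strongly_achievable_product: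
  fixes A :: "'x::finite pmf" and B :: "'y::finite pmf" and C :: "'z::finite pmf"
  assumes "R \<ge> 0"
  shows "strongly_achievable R (pair_pmf A (pair_pmf B C))"
proof -
  let ?p = "pair_pmf A (pair_pmf B C)"
  have "pmf (induced_pmf R n (\<lambda>_. block_pmf n (\<lambda>_. A)) (\<lambda>_. block_pmf n (\<lambda>_. B)) (\<lambda>_. block_pmf n (\<lambda>_. C))) a
     = iid_mass ?p n a" if "a \<in> blocks n" for n a
    using pmf_induced_block[OF assms that, of "\<lambda>_. A" "\<lambda>_ _. 0" "\<lambda>_. B" "\<lambda>_. C"]
      common_randomness_nonempty[OF assms, of n]
    by (simp add: iid_mass_letter)
  then have "tv_dist (blocks n) (pmf (induced_pmf R n (\<lambda>_. block_pmf n (\<lambda>_. A)) (\<lambda>_. block_pmf n (\<lambda>_. B)) (\<lambda>_. block_pmf n (\<lambda>_. C))))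
     (iid_mass ?p n) = 0" for n
    by (simp add: tv_dist_def)
  then show ?thesis
    unfolding strongly_achievable_def
    by (intro exI[of _ "\<lambda>n _. block_pmf n (\<lambda>_. A)"] exI[of _ "\<lambda>n _. block_pmf n (\<lambda>_. B)"]
       exI[of _ "\<lambda>n _. block_pmf n (\<lambda>_. C)"]) (simp add: is_decoder_block_pmf)
qed

text \<open>Apply \<open>soft_covering\<close> to words over \<open>U\<close> with independent
  letters of law \<open>P\<close>, with cutoff exp (n \<kappa>) and tail \<theta>^n. As \<kappa>
  lies below \<open>R * ln 2\<close>, the codebook outgrows the cutoff exponentially; as it lies
  above the information, the tail decays exponentially.\<close>

lemma strongly_achievable_of_rate_gap:
  fixes A :: "nat \<Rightarrow> 'x::finite pmf" and B :: "nat \<Rightarrow> 'y::finite pmf" and C :: "nat \<Rightarrow> 'z::finite pmf"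
    and p :: "('x \<times> 'y \<times> 'z) pmf"
  defines "V \<equiv> \<lambda>u. pair_pmf (A u) (pair_pmf (B u) (C u))"
  assumes R: "R \<ge> 0" and U: "finite U" "\<And>u. u \<in> U \<Longrightarrow> 0 < P u" "sum P U = 1"
    and p: "\<And>s. pmf p s = (\<Sum>u\<in>U. P u * pmf (V u) s)"
    and gap: "(\<Sum>u\<in>U. \<Sum>s\<in>UNIV. P u * pmf (V u) s * ln (pmf (V u) s / pmf p s)) < R * ln 2"
  shows "strongly_achievable R p"
proof -
  define l where "l = (\<lambda>u s. ln (pmf (V u) s / pmf p s))"
  obtain \<kappa> where \<kappa>: "(\<Sum>u\<in>U. \<Sum>s\<in>UNIV. P u * pmf (V u) s * l u s) < \<kappa>" "\<kappa> < R * ln 2"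
    using dense[OF gap] unfolding l_def by blast
  have wsum: "(\<Sum>(u, s)\<in>U \<times> UNIV. P u * pmf (V u) s) = 1"
    using U by (simp add: sum.cartesian_product[symmetric] sum_pmf_eq_1 flip: sum_distrib_left)
  obtain t where t: "t > 0"
    "exp (- t * \<kappa>) * (\<Sum>(u, s)\<in>U \<times> UNIV. P u * pmf (V u) s * exp (t * l u s)) < 1"
    using chernoff_exponent[of "U \<times> UNIV" "\<lambda>(u, s). P u * pmf (V u) s" "\<lambda>(u, s). l u s" \<kappa>] wsum \<kappa>(1) U(1)
    by (auto simp: split_def sum.cartesian_product)
  \<comment> \<open>Single-letter Chernoff factor: its n-th power bounds the mass of pairs whose
    log-likelihood ratio exceeds n \<kappa>.\<close>
  define \<theta> where "\<theta> = (\<Sum>u\<in>U. \<Sum>s\<in>UNIV. P u * pmf (V u) s * exp (t * (l u s - \<kappa>)))"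
  have \<theta>1: "\<theta> < 1"
  proof -
    have "\<theta> = exp (- t * \<kappa>) * (\<Sum>(u, s)\<in>U \<times> UNIV. P u * pmf (V u) s * exp (t * l u s))"
      unfolding \<theta>_def
      by (simp add: sum.cartesian_product[symmetric] sum_distrib_left right_diff_distrib exp_diff exp_minus field_simps)
    then show ?thesis using t by simp
  qed
  \<comment> \<open>Positivity is required because \<open>soft_covering\<close> divides by the tail
    bound.\<close>
  have \<theta>0: "\<theta> > 0"
  proof -
    have "\<exists>x\<in>U \<times> UNIV. (case x of (u, s) \<Rightarrow> P u * pmf (V u) s) \<noteq> 0"
      using wsum sum.neutral[of "U \<times> UNIV" "\<lambda>(u, s). P u * pmf (V u) s"] by fastforce
    then obtain u s where us: "u \<in> U" "P u * pmf (V u) s \<noteq> 0" by auto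
    have nn: "0 \<le> P u * pmf (V u) s * exp (t * (l u s - \<kappa>))" if "u \<in> U" for u s
      using U(2)[OF that] by simp
    have "0 < P u * pmf (V u) s * exp (t * (l u s - \<kappa>))"
      using us nn[of u s] by (auto simp: less_le)
    also have "\<dots> \<le> (\<Sum>s\<in>UNIV. P u * pmf (V u) s * exp (t * (l u s - \<kappa>)))"
      using nn us by (intro member_le_sum) auto
    also have "\<dots> \<le> \<theta>" unfolding \<theta>_def
      using us U nn by (intro member_le_sum[where f = "\<lambda>u. \<Sum>s\<in>UNIV. P u * pmf (V u) s * exp (t * (l u s - \<kappa>))"] sum_nonneg) auto
    finally show ?thesis .
  qed
  define M where "M = (\<lambda>n. card (common_randomness R n))"
  have M: "M n \<ge> 1" "2 powr (real n * R) / 2 \<le> M n" for n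
    using card_common_randomness_bounds[OF R] by (simp_all add: M_def)
  have "\<exists>f :: nat \<Rightarrow> nat \<Rightarrow> nat. (\<Sum>a\<in>blocks n. \<bar>(\<Sum>k<M n. \<Prod>i<n. pmf (V (f k i)) (letter i a)) / M n - iid_mass p n a\<bar>)
      \<le> sqrt (2 * exp (n * \<kappa>) / M n) + 3 * \<theta> ^ n" for n
  proof -
    define X where "X = (PiE {..<n} (\<lambda>_. U))"
    define \<mu> where "\<mu> = (\<lambda>c. \<Prod>i<n. P (c i))"
    define D where "D = (\<lambda>c a. \<Prod>i<n. pmf (V (c i)) (letter i a))"
    \<comment> \<open>Averaging over independent codeword letters commutes with the product over
      coordinates, so the target is exactly the i.i.d. law.\<close>
    have Q: "(\<Sum>c\<in>X. \<mu> c * D c a) = iid_mass p n a" for a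
    proof -
      have "(\<Sum>c\<in>X. \<mu> c * D c a) = (\<Sum>c\<in>X. \<Prod>i<n. P (c i) * pmf (V (c i)) (letter i a))"
        by (simp add: \<mu>_def D_def prod.distrib)
      also have "\<dots> = (\<Prod>i<n. \<Sum>u\<in>U. P u * pmf (V u) (letter i a))"
        unfolding X_def by (subst prod_sum_PiE) (use U in auto)
      finally show ?thesis by (simp add: iid_mass_letter p)
    qed
    have \<mu>pos: "0 < \<mu> c" if "c \<in> X" for c
      using that U by (auto simp: \<mu>_def X_def intro!: prod_pos)
    have \<mu>1: "sum \<mu> X = 1"
      unfolding \<mu>_def X_def using prod_sum_PiE[of "{..<n}" "\<lambda>_. U" "\<lambda>_. P"] U by simp
    \<comment> \<open>Markov bound in pointwise form: on a pair above the cutoff the sum of the log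
      ratios exceeds n \<kappa>, so the exponential factor is at least 1.\<close>
    have Dtail: "(if D c a \<le> exp (n * \<kappa>) * iid_mass p n a then 0 else D c a) \<le>
       D c a * (\<Prod>i<n. exp (t * (l (c i) (letter i a) - \<kappa>)))" if c: "c \<in> X" for c a
    proof (cases "D c a \<le> exp (n * \<kappa>) * iid_mass p n a")
      case False
      have "0 \<le> exp (n * \<kappa>) * iid_mass p n a" using iid_mass_nonneg[of p n a] by simp
      then have "D c a > 0" using False by linarith
      then have V: "pmf (V (c i)) (letter i a) > 0" if "i < n" for i
        using that by (auto simp: D_def less_le)
      have pp: "pmf p (letter i a) > 0" if "i < n" for i
      proof -
        have "c i \<in> U" using c that by (auto simp: X_def)
        then show ?thesis unfolding p using V[OF that] U
          by (intro sum_pos2[of _ "c i"]) (auto simp: less_imp_le)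
      qed
      have "D c a = iid_mass p n a * exp (\<Sum>i<n. l (c i) (letter i a))"
        unfolding D_def iid_mass_letter exp_sum[OF finite_lessThan] prod.distrib[symmetric]
      proof (intro prod.cong refl)
        fix i assume "i \<in> {..<n}"
        then show "pmf (V (c i)) (letter i a) = pmf p (letter i a) * exp (l (c i) (letter i a))"
          using V[of i] pp[of i] by (simp add: l_def)
      qed
      moreover have "0 < iid_mass p n a" using pp by (auto simp: iid_mass_letter intro!: prod_pos)
      ultimately have "exp (n * \<kappa>) < exp (\<Sum>i<n. l (c i) (letter i a))"
        using False by (simp add: mult.commute)
      then have "n * \<kappa> < (\<Sum>i<n. l (c i) (letter i a))" by simp
      then have "0 \<le> t * (\<Sum>i<n. l (c i) (letter i a) - \<kappa>)"
        using t(1) by (simp add: sum_subtractf)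
      then have "1 \<le> (\<Prod>i<n. exp (t * (l (c i) (letter i a) - \<kappa>)))"
        by (simp flip: exp_sum sum_distrib_left)
      then show ?thesis using False \<open>D c a > 0\<close> by simp
    qed (auto simp: D_def intro!: mult_nonneg_nonneg prod_nonneg)
    have "(\<Sum>c\<in>X. \<mu> c * (\<Sum>a\<in>blocks n. if D c a \<le> exp (n * \<kappa>) * iid_mass p n a then 0 else D c a))
       \<le> (\<Sum>c\<in>X. \<mu> c * (\<Sum>a\<in>blocks n. D c a * (\<Prod>i<n. exp (t * (l (c i) (letter i a) - \<kappa>)))))"
      using Dtail \<mu>pos by (intro sum_mono mult_left_mono) (auto simp: less_imp_le)
    also have "\<dots> = (\<Sum>c\<in>X. \<Sum>a\<in>blocks n. \<Prod>i<n. P (c i) * pmf (V (c i)) (letter i a) * exp (t * (l (c i) (letter i a) - \<kappa>)))"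
      by (simp add: \<mu>_def D_def prod.distrib sum_distrib_left mult.assoc)
    also have "\<dots> = (\<Sum>c\<in>X. \<Prod>i<n. \<Sum>s\<in>UNIV. P (c i) * pmf (V (c i)) s * exp (t * (l (c i) s - \<kappa>)))"
    proof (rule sum.cong[OF refl])
      fix c
      show "(\<Sum>a\<in>blocks n. \<Prod>i<n. P (c i) * pmf (V (c i)) (letter i a) * exp (t * (l (c i) (letter i a) - \<kappa>))) =
        (\<Prod>i<n. \<Sum>s\<in>UNIV. P (c i) * pmf (V (c i)) s * exp (t * (l (c i) s - \<kappa>)))"
        by (rule sum_blocks_prod[where g = "\<lambda>i s. P (c i) * pmf (V (c i)) s * exp (t * (l (c i) s - \<kappa>))"])
    qed
    also have "\<dots> = \<theta> ^ n"
      unfolding X_def \<theta>_def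
      using prod_sum_PiE[of "{..<n}" "\<lambda>_. U" "\<lambda>_ u. \<Sum>s\<in>UNIV. P u * pmf (V u) s * exp (t * (l u s - \<kappa>))"] U
      by simp
    finally have tail: "(\<Sum>c\<in>X. \<mu> c * (\<Sum>a\<in>blocks n. if D c a \<le> exp (n * \<kappa>) * iid_mass p n a then 0 else D c a)) \<le> \<theta> ^ n" .
    have finX: "finite X" using U by (auto simp: X_def intro: finite_PiE)
    have D0: "0 \<le> D c a" for c a by (simp add: D_def prod_nonneg)
    have "\<exists>f :: nat \<Rightarrow> nat \<Rightarrow> nat. (\<forall>k. f k \<in> X) \<and> (\<Sum>a\<in>blocks n. \<bar>(\<Sum>k<M n. D (f k) a) / M n - (\<Sum>c\<in>X. \<mu> c * D c a)\<bar>)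
      \<le> sqrt (2 * exp (n * \<kappa>) / M n) + 3 * \<theta> ^ n"
      by (rule soft_covering[OF finX finite_blocks \<mu>pos \<mu>1])
        (use tail \<theta>0 M(1) D0 in \<open>simp_all add: Q sum_iid_mass\<close>)
    then show ?thesis unfolding Q unfolding D_def by blast
  qed
  then have "\<forall>n. \<exists>f :: nat \<Rightarrow> nat \<Rightarrow> nat. (\<Sum>a\<in>blocks n. \<bar>(\<Sum>k<M n. \<Prod>i<n. pmf (V (f k i)) (letter i a)) / M n - iid_mass p n a\<bar>)
      \<le> sqrt (2 * exp (n * \<kappa>) / M n) + 3 * \<theta> ^ n"
    by (rule allI)
  from choice[OF this] obtain f :: "nat \<Rightarrow> nat \<Rightarrow> nat \<Rightarrow> nat" where
    f: "\<And>n. (\<Sum>a\<in>blocks n. \<bar>(\<Sum>k<M n. \<Prod>i<n. pmf (V (f n k i)) (letter i a)) / M n - iid_mass p n a\<bar>)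
      \<le> sqrt (2 * exp (n * \<kappa>) / M n) + 3 * \<theta> ^ n"
    by (auto simp only:)
  \<comment> \<open>The common randomness starts at 1 and the codebook at 0, hence
    \<open>\<omega> - 1\<close>.\<close>
  define ind where "ind = (\<lambda>n. induced_pmf R n (\<lambda>\<omega>. block_pmf n (\<lambda>i. A (f n (\<omega> - 1) i)))
      (\<lambda>\<omega>. block_pmf n (\<lambda>i. B (f n (\<omega> - 1) i))) (\<lambda>\<omega>. block_pmf n (\<lambda>i. C (f n (\<omega> - 1) i))))"
  have ind: "pmf (ind n) a = (\<Sum>k<M n. \<Prod>i<n. pmf (V (f n k i)) (letter i a)) / M n" if "a \<in> blocks n" for n a
  proof -
    have "common_randomness R n = {1..M n}" by (simp add: M_def common_randomness_eq)
    then have "(\<Sum>\<omega>\<in>common_randomness R n. \<Prod>i<n. pmf (V (f n (\<omega> - 1) i)) (letter i a)) =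
       (\<Sum>k<M n. \<Prod>i<n. pmf (V (f n k i)) (letter i a))"
      by (intro sum.reindex_bij_witness[of _ Suc "\<lambda>\<omega>. \<omega> - 1"]) auto
    then show ?thesis
      using pmf_induced_block[OF R that, of A "\<lambda>\<omega>. f n (\<omega> - 1)" B C] by (simp add: ind_def V_def M_def)
  qed
  have tv: "tv_dist (blocks n) (pmf (ind n)) (iid_mass p n) \<le> sqrt (4 * exp (n * (\<kappa> - R * ln 2))) + 3 * \<theta> ^ n" for n
  proof -
    have "(\<Sum>a\<in>blocks n. \<bar>pmf (ind n) a - iid_mass p n a\<bar>) \<le> sqrt (2 * exp (n * \<kappa>) / M n) + 3 * \<theta> ^ n"
      using f[of n] by (simp add: ind)
    moreover have "sqrt (2 * exp (n * \<kappa>) / M n) \<le> sqrt (4 * exp (n * (\<kappa> - R * ln 2)))"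
    proof (rule real_sqrt_le_mono)
      \<comment> \<open>The constant 4 is the 2 of \<open>soft_covering\<close> times the 2 lost by
        rounding the codebook size.\<close>
      have "2 * exp (n * \<kappa>) / M n \<le> 2 * exp (n * \<kappa>) / (2 powr (real n * R) / 2)"
        using M[of n] by (intro divide_left_mono) auto
      also have "\<dots> = 4 * exp (n * (\<kappa> - R * ln 2))"
        by (simp add: powr_def right_diff_distrib exp_diff mult.assoc)
      finally show "2 * exp (n * \<kappa>) / M n \<le> 4 * exp (n * (\<kappa> - R * ln 2))" .
    qed
    moreover have "0 \<le> (\<Sum>a\<in>blocks n. \<bar>pmf (ind n) a - iid_mass p n a\<bar>)" by (intro sum_nonneg) auto
    ultimately show ?thesis unfolding tv_dist_def by linarith
  qed
  have "(\<lambda>n. exp (\<kappa> - R * ln 2) ^ n) \<longlonglongrightarrow> 0" using \<kappa>(2) by (intro LIMSEQ_power_zero) auto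
  then have e: "(\<lambda>n. exp (real n * (\<kappa> - R * ln 2))) \<longlonglongrightarrow> 0" by (simp add: exp_of_nat_mult)
  have "(\<lambda>n. \<theta> ^ n) \<longlonglongrightarrow> 0" using \<theta>0 \<theta>1 by (intro LIMSEQ_power_zero) auto
  from tendsto_add[OF tendsto_real_sqrt[OF tendsto_mult[OF tendsto_const e]] tendsto_mult[OF tendsto_const this], of 4 3]
  have "(\<lambda>n. sqrt (4 * exp (real n * (\<kappa> - R * ln 2))) + 3 * \<theta> ^ n) \<longlonglongrightarrow> 0" by simp
  moreover have "0 \<le> tv_dist (blocks n) (pmf (ind n)) (iid_mass p n)" for n
    by (simp add: tv_dist_def sum_nonneg)
  ultimately have lim: "(\<lambda>n. tv_dist (blocks n) (pmf (ind n)) (iid_mass p n)) \<longlonglongrightarrow> 0"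
    using tv by - (rule real_tendsto_sandwich[where f = "\<lambda>_. 0"], simp_all only: tendsto_const eventually_True)
  show ?thesis
    unfolding strongly_achievable_def
    by (intro exI[of _ "\<lambda>n \<omega>. block_pmf n (\<lambda>i. A (f n (\<omega> - 1) i))"] exI[of _ "\<lambda>n \<omega>. block_pmf n (\<lambda>i. B (f n (\<omega> - 1) i))"]
       exI[of _ "\<lambda>n \<omega>. block_pmf n (\<lambda>i. C (f n (\<omega> - 1) i))"] conjI)
      (use lim in \<open>auto simp: is_decoder_block_pmf ind_def\<close>)
qed

subsection \<open>Mixtures of product distributions\<close>

definition product_dist :: "('x \<times> 'y \<times> 'z) pmf \<Rightarrow> bool" where
  "product_dist v \<longleftrightarrow> (\<exists>A B C. v = pair_pmf A (pair_pmf B C))"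

text \<open>Strict positivity of the weights puts the support of every component inside that of
  \<open>p\<close>, as \<open>product_mixture_pos\<close> records; the logarithms below rely on
  it.\<close>

definition product_mixture ::
  "nat set \<Rightarrow> (nat \<Rightarrow> real) \<Rightarrow> (nat \<Rightarrow> ('x \<times> 'y \<times> 'z) pmf) \<Rightarrow> ('x \<times> 'y \<times> 'z) pmf \<Rightarrow> bool" where
  "product_mixture U P V p \<longleftrightarrow> finite U \<and> (\<forall>u\<in>U. 0 < P u) \<and> sum P U = 1 \<and>
     (\<forall>u\<in>U. product_dist (V u)) \<and> (\<forall>s. pmf p s = (\<Sum>u\<in>U. P u * pmf (V u) s))"

text \<open>The mutual information in nats, written as entropy minus conditional entropy;
  \<open>mutual_info_mixture\<close> converts it to bits.\<close>

definition mixture_info ::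
  "nat set \<Rightarrow> (nat \<Rightarrow> real) \<Rightarrow> (nat \<Rightarrow> 's::finite pmf) \<Rightarrow> 's pmf \<Rightarrow> real" where
  "mixture_info U P V p = entf UNIV (pmf p) - (\<Sum>u\<in>U. P u * entf UNIV (pmf (V u)))"

lemma product_mixtureD:
  assumes "product_mixture U P V p"
  shows "finite U" "u \<in> U \<Longrightarrow> 0 < P u" "sum P U = 1" "u \<in> U \<Longrightarrow> product_dist (V u)"
    "pmf p s = (\<Sum>u\<in>U. P u * pmf (V u) s)"
  using assms unfolding product_mixture_def by blast+

lemma product_mixture_pos:
  assumes "product_mixture U P V p" "u \<in> U" "pmf (V u) s > 0"
  shows "pmf p s > 0"
proof -
  have "pmf p s = (\<Sum>u\<in>U. P u * pmf (V u) s)" by (rule product_mixtureD(5)[OF assms(1)])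
  then show ?thesis using assms
    by (auto simp: product_mixture_def less_imp_le intro!: sum_pos2[of U u])
qed

text \<open>The bracket is the divergence D(V_u || p), cross entropy minus entropy. The mean of the
  cross entropies is the entropy of \<open>p\<close>, because \<open>p\<close> is the
  mixture.\<close>

lemma mixture_info_mean:
  fixes p :: "('x::finite \<times> 'y::finite \<times> 'z::finite) pmf"
  assumes m: "product_mixture U P V p"
  shows "(\<Sum>u\<in>U. P u * (- (\<Sum>s\<in>UNIV. pmf (V u) s * ln (pmf p s)) - entf UNIV (pmf (V u)))) = mixture_info U P V p"
proof -
  have "(\<Sum>s\<in>UNIV. pmf p s * ln (pmf p s)) = (\<Sum>s\<in>UNIV. (\<Sum>u\<in>U. P u * pmf (V u) s) * ln (pmf p s))"
    by (intro sum.cong refl arg_cong2[where f = "(*)"] product_mixtureD(5)[OF m])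
  also have "\<dots> = (\<Sum>u\<in>U. P u * (\<Sum>s\<in>UNIV. pmf (V u) s * ln (pmf p s)))"
    by (simp add: sum_distrib_left sum_distrib_right mult.assoc sum.swap[of _ U UNIV])
  finally show ?thesis
    by (simp add: mixture_info_def entf_def right_diff_distrib sum_subtractf sum_negf)
qed

text \<open>The form with likelihood ratios, which both the Chernoff argument and
  \<open>mutual_info_eq\<close> use. The logarithm splits where \<open>V u\<close> has mass;
  elsewhere both sides are 0.\<close>

lemma mixture_info_eq:
  fixes p :: "('x::finite \<times> 'y::finite \<times> 'z::finite) pmf"
  assumes "product_mixture U P V p"
  shows "mixture_info U P V p = (\<Sum>u\<in>U. \<Sum>s\<in>UNIV. P u * pmf (V u) s * ln (pmf (V u) s / pmf p s))"
proof -
  have "P u * pmf (V u) s * ln (pmf (V u) s / pmf p s) = P u * (pmf (V u) s * ln (pmf (V u) s) - pmf (V u) s * ln (pmf p s))"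
    if u: "u \<in> U" for u s
  proof (cases "pmf (V u) s = 0")
    case False
    then have "pmf (V u) s > 0" by (simp add: less_le)
    moreover from this have "pmf p s > 0" by (rule product_mixture_pos[OF assms u])
    ultimately show ?thesis by (simp add: ln_div algebra_simps)
  qed simp
  then have "(\<Sum>u\<in>U. \<Sum>s\<in>UNIV. P u * pmf (V u) s * ln (pmf (V u) s / pmf p s)) =
    (\<Sum>u\<in>U. \<Sum>s\<in>UNIV. P u * (pmf (V u) s * ln (pmf (V u) s) - pmf (V u) s * ln (pmf p s)))"
    by (intro sum.cong refl) auto
  also have "\<dots> = (\<Sum>u\<in>U. P u * (- (\<Sum>s\<in>UNIV. pmf (V u) s * ln (pmf p s)) - entf UNIV (pmf (V u))))"
    by (simp add: entf_def sum_subtractf flip: sum_distrib_left)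
  finally show ?thesis using mixture_info_mean[OF assms] by simp
qed

lemma strongly_achievable_of_mixture:
  fixes p :: "('x::finite \<times> 'y::finite \<times> 'z::finite) pmf"
  assumes R: "R \<ge> 0" and m: "product_mixture U P V p" and I: "mixture_info U P V p < R * ln 2"
  shows "strongly_achievable R p"
proof -
  have "\<exists>A B C. \<forall>u\<in>U. V u = pair_pmf (A u) (pair_pmf (B u) (C u))"
    using m by (simp add: product_mixture_def product_dist_def) metis
  then obtain A B C where V: "\<And>u. u \<in> U \<Longrightarrow> V u = pair_pmf (A u) (pair_pmf (B u) (C u))" by blast
  show ?thesis
    by (rule strongly_achievable_of_rate_gap[OF R, of U P p A B C])
      (use product_mixtureD[OF m] I in \<open>auto simp: mixture_info_eq[OF m] simp flip: V\<close>)
qed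

section \<open>Achievability including equality\<close>

text \<open>The mean of the divergences D(V_u || p) is at most 0, so one of them is, and strict
  Gibbs then forces that component to equal \<open>p\<close>.\<close>

lemma mixture_info_eq_0:
  fixes p :: "('x::finite \<times> 'y::finite \<times> 'z::finite) pmf"
  assumes m: "product_mixture U P V p" and I: "mixture_info U P V p \<le> 0"
  shows "product_dist p"
proof -
  define D where "D = (\<lambda>u. - (\<Sum>s\<in>UNIV. pmf (V u) s * ln (pmf p s)) - entf UNIV (pmf (V u)))"
  have "(\<Sum>u\<in>U. P u * D u) = mixture_info U P V p"
    unfolding D_def by (rule mixture_info_mean[OF m])
  then obtain u where u: "u \<in> U" "D u \<le> 0"
    using exists_le_weighted_mean[of U P D 0] m I by (auto simp: product_mixture_def)
  have "pmf (V u) s = pmf p s" for s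
  proof (rule ccontr)
    assume "pmf (V u) s \<noteq> pmf p s"
    then have "entf UNIV (pmf (V u)) < - (\<Sum>s\<in>UNIV. pmf (V u) s * ln (pmf p s))"
      using product_mixture_pos[OF m u(1)]
      by (intro gibbs_strict[where b = s]) (auto simp: sum_pmf_eq_1)
    then show False using u(2) by (simp add: D_def)
  qed
  then have "V u = p" by (intro pmf_eqI)
  then show ?thesis using m u by (auto simp: product_mixture_def)
qed

text \<open>The choice $v = V_w$ with $D(V_w \| p) \le I$ works for all $t$:
  the information of the perturbed mixture is $(1-t) I + t D(V_w \| p) - D(q \| p)$.\<close>

lemma mixture_perturbation:
  fixes p :: "('x::finite \<times> 'y::finite \<times> 'z::finite) pmf"
  assumes m: "product_mixture U P V p" and I: "mixture_info U P V p > 0"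
  shows "\<exists>v. \<forall>t q. 0 < t \<longrightarrow> t < 1 \<longrightarrow> (\<forall>s. pmf q s = (1 - t) * pmf p s + t * pmf v s) \<longrightarrow>
     (\<exists>P'. product_mixture U P' V q \<and> mixture_info U P' V q < mixture_info U P V p)"
proof -
  define c where "c = mixture_info U P V p"
  define D where "D = (\<lambda>u. - (\<Sum>s\<in>UNIV. pmf (V u) s * ln (pmf p s)) - entf UNIV (pmf (V u)))"
  have U: "finite U" "\<And>u. u \<in> U \<Longrightarrow> 0 < P u" "sum P U = 1"
    and p: "\<And>s. pmf p s = (\<Sum>u\<in>U. P u * pmf (V u) s)"
    using product_mixtureD[OF m] by auto
  have "(\<Sum>u\<in>U. P u * D u) = c"
    unfolding D_def c_def by (rule mixture_info_mean[OF m])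
  then obtain w where w: "w \<in> U" "D w \<le> c"
    using exists_le_weighted_mean[of U P D c] U by auto
  have "\<exists>P'. product_mixture U P' V q \<and> mixture_info U P' V q < c"
    if t: "0 < t" "t < 1" and q: "\<And>s. pmf q s = (1 - t) * pmf p s + t * pmf (V w) s" for t q
  proof -
    \<comment> \<open>The old weights scaled by 1 - t, with the freed weight t placed on
      \<open>w\<close>.\<close>
    define P' where "P' = (\<lambda>u. (1 - t) * P u + (if u = w then t else 0))"
    have P'sum: "(\<Sum>u\<in>U. P' u * F u) = (1 - t) * (\<Sum>u\<in>U. P u * F u) + t * F w" for F :: "nat \<Rightarrow> real"
    proof -
      have "P' u * F u = (1 - t) * (P u * F u) + (if u = w then t * F u else 0)" for u
        by (simp add: P'_def distrib_right)
      then show ?thesis using U(1) w(1) by (simp add: sum.distrib sum_distrib_left)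
    qed
    have "product_mixture U P' V q"
      unfolding product_mixture_def
    proof (intro conjI ballI allI)
      show "sum P' U = 1" using P'sum[of "\<lambda>_. 1"] U by simp
      show "0 < P' u" if "u \<in> U" for u using U(2)[OF that] t by (auto simp: P'_def intro: add_pos_nonneg)
      show "pmf q s = (\<Sum>u\<in>U. P' u * pmf (V u) s)" for s by (simp add: P'sum q p)
    qed (use m in \<open>auto simp: product_mixture_def\<close>)
    moreover have "mixture_info U P' V q < c"
    proof -
      \<comment> \<open>Absolute continuity of \<open>q\<close> with respect to \<open>p\<close>,
        required for Gibbs; it holds since the support of \<open>V w\<close> lies in that of
        \<open>p\<close>.\<close>
      have qp: "pmf p s > 0" if "pmf q s > 0" for s
        using that product_mixture_pos[OF m w(1), of s] q[of s] t
        by (cases "pmf p s = 0"; cases "pmf (V w) s = 0") (auto simp: less_le)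
      have cross: "- (\<Sum>s\<in>UNIV. pmf q s * ln (pmf p s)) =
         (1 - t) * entf UNIV (pmf p) + t * (D w + entf UNIV (pmf (V w)))"
      proof -
        have "pmf q s * ln (pmf p s) = (1 - t) * (pmf p s * ln (pmf p s)) + t * (pmf (V w) s * ln (pmf p s))" for s
          by (simp add: q algebra_simps)
        then have "(\<Sum>s\<in>UNIV. pmf q s * ln (pmf p s)) = (1 - t) * (\<Sum>s\<in>UNIV. pmf p s * ln (pmf p s))
            + t * (\<Sum>s\<in>UNIV. pmf (V w) s * ln (pmf p s))"
          by (simp add: sum.distrib flip: sum_distrib_left)
        then show ?thesis by (simp add: entf_def[of _ "pmf p"] D_def)
      qed
      have split: "mixture_info U P' V q = entf UNIV (pmf q) - ((1 - t) * (\<Sum>u\<in>U. P u * entf UNIV (pmf (V u))) + t * entf UNIV (pmf (V w)))"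
        by (simp only: mixture_info_def P'sum)
      have tc: "(1 - t) * c = c - t * c" by (simp add: left_diff_distrib)
      have bound: "- (\<Sum>s\<in>UNIV. pmf q s * ln (pmf p s)) - ((1 - t) * (\<Sum>u\<in>U. P u * entf UNIV (pmf (V u))) + t * entf UNIV (pmf (V w)))
         = (1 - t) * c + t * D w"
        unfolding cross c_def mixture_info_def by (simp add: distrib_left right_diff_distrib)
      have tD: "t * D w \<le> t * c" using w t by (intro mult_left_mono) auto
      show ?thesis
      \<comment> \<open>If \<open>V w = p\<close>, then q = p and D(V_w || p) = 0, and the decrease
        is at least t c > 0. Otherwise q differs from p, and the decrease comes from strict
        Gibbs.\<close>
      proof (cases "V w = p")
        case True
        then have "pmf q s = pmf p s" for s by (simp add: q algebra_simps)
        then have "D w = 0" using True by (simp add: D_def entf_def)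
        moreover have "entf UNIV (pmf q) \<le> - (\<Sum>s\<in>UNIV. pmf q s * ln (pmf p s))"
          using qp by (intro gibbs) (auto simp: sum_pmf_eq_1)
        moreover have "0 < t * c" using t I by (simp add: c_def)
        ultimately show ?thesis using split bound tc by simp
      next
        case False
        then obtain s where s: "pmf (V w) s \<noteq> pmf p s" by (meson pmf_eqI)
        have "pmf q s - pmf p s = t * (pmf (V w) s - pmf p s)" by (simp add: q algebra_simps)
        then have "pmf q s \<noteq> pmf p s" using s t by auto
        then have "entf UNIV (pmf q) < - (\<Sum>s\<in>UNIV. pmf q s * ln (pmf p s))"
          using qp by (intro gibbs_strict[where b = s]) (auto simp: sum_pmf_eq_1)
        then show ?thesis using split bound tD tc by linarith
      qed
    qed
    ultimately show ?thesis by blast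
  qed
  then show ?thesis unfolding c_def by blast
qed

text \<open>The perturbation is used whenever the information is positive, so equality with the rate
  and strict inequality are treated alike: all perturbed laws are achievable and they converge to
  \<open>p\<close>.\<close>

lemma mixture_in_strong_capacity_region:
  fixes p :: "('x::finite \<times> 'y::finite \<times> 'z::finite) pmf"
  assumes R: "R \<ge> 0" and m: "product_mixture U P V p" and I: "mixture_info U P V p \<le> R * ln 2"
  shows "p \<in> strong_capacity_region R"
proof -
  have *: "q \<in> strong_capacity_region R" if "strongly_achievable R q" for q :: "('x \<times> 'y \<times> 'z) pmf"
    using that closure_subset[of "pmf_vec ` {q. strongly_achievable R q}"] by (auto simp: strong_capacity_region_def)
  show ?thesis
  proof (cases "mixture_info U P V p \<le> 0")
    case True
    then have "product_dist p" by (rule mixture_info_eq_0[OF m])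
    then show ?thesis using strongly_achievable_product[OF R] by (auto simp: product_dist_def intro!: *)
  next
    case False
    then obtain v where v: "\<And>t q. 0 < t \<Longrightarrow> t < 1 \<Longrightarrow> (\<And>s. pmf q s = (1 - t) * pmf p s + t * pmf v s) \<Longrightarrow>
     (\<exists>P'. product_mixture U P' V q \<and> mixture_info U P' V q < mixture_info U P V p)"
      using mixture_perturbation[OF m] unfolding not_le by blast
    \<comment> \<open>The double successor keeps \<open>t n\<close> strictly below 1.\<close>
    define t where "t = (\<lambda>n. inverse (real (Suc (Suc n))))"
    have t: "0 < t n" "t n < 1" for n by (auto simp: t_def field_simps)
    define q where "q = (\<lambda>n. bind_pmf (bernoulli_pmf (t n)) (\<lambda>b. if b then v else p))"
    have q: "pmf (q n) s = (1 - t n) * pmf p s + t n * pmf v s" for n s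
      using t[of n] by (simp add: q_def pmf_bind integral_bernoulli_pmf less_imp_le)
    have "strongly_achievable R (q n)" for n
    proof -
      obtain P' where P': "product_mixture U P' V (q n)" "mixture_info U P' V (q n) < mixture_info U P V p"
        using v[OF t q] by blast
      have "mixture_info U P' V (q n) < R * ln 2" using P'(2) I by linarith
      then show ?thesis by (rule strongly_achievable_of_mixture[OF R P'(1)])
    qed
    moreover have "(\<lambda>n. pmf_vec (q n)) \<longlonglongrightarrow> pmf_vec p"
    proof (rule vec_tendstoI)
      fix s
      have "t \<longlonglongrightarrow> 0" unfolding t_def
        using LIMSEQ_inverse_real_of_nat by (rule LIMSEQ_Suc)
      then have "(\<lambda>n. (1 - t n) * pmf p s + t n * pmf v s) \<longlonglongrightarrow> (1 - 0) * pmf p s + 0 * pmf v s"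
        by (intro tendsto_intros)
      then show "(\<lambda>n. pmf_vec (q n) $ s) \<longlonglongrightarrow> pmf_vec p $ s" by (simp add: pmf_vec_def q)
    qed
    ultimately show ?thesis
      unfolding strong_capacity_region_def closure_sequential
      by (auto intro!: exI[of _ "\<lambda>n. pmf_vec (q n)"])
  qed
qed

section \<open>Joint laws with an auxiliary variable versus product mixtures\<close>

text \<open>The second marginal of \<open>J\<close> at u is \<open>P u\<close>, which cancels in the
  likelihood ratio; the factor 1 / ln 2 is the change from nats to bits.\<close>

lemma mutual_info_mixture:
  fixes J :: "(('x::finite \<times> 'y::finite \<times> 'z::finite) \<times> nat) pmf"
  assumes m: "product_mixture U P V p"
    and J: "\<And>s u. pmf J (s, u) = (if u \<in> U then P u * pmf (V u) s else 0)"
    and p: "map_pmf fst J = p"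
  shows "mutual_info J = mixture_info U P V p / ln 2"
proof -
  have U: "finite U" "\<And>u. u \<in> U \<Longrightarrow> 0 < P u" using product_mixtureD[OF m] by auto
  have Pu: "pmf (map_pmf snd J) u = P u" if "u \<in> U" for u
  proof -
    have "pmf (map_pmf snd J) u = measure J (UNIV \<times> {u})"
      by (simp add: pmf_map vimage_snd)
    also have "\<dots> = (\<Sum>(s, v)\<in>UNIV \<times> {u}. pmf J (s, v))"
      by (subst measure_measure_pmf_finite) auto
    also have "\<dots> = P u" using that
      by (simp add: sum.cartesian_product[symmetric] J sum_pmf_eq_1 flip: sum_distrib_left)
    finally show ?thesis .
  qed
  have "mutual_info J = (\<Sum>s\<in>UNIV. \<Sum>u\<in>U. pmf J (s, u) *
     log 2 (pmf J (s, u) / (pmf (map_pmf fst J) s * pmf (map_pmf snd J) u)))"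
    by (rule mutual_info_eq[OF U(1)]) (auto simp: set_pmf_iff J split: if_splits)
  also have "\<dots> = (\<Sum>s\<in>UNIV. \<Sum>u\<in>U. P u * pmf (V u) s * ln (pmf (V u) s / pmf p s) / ln 2)"
  proof (intro sum.cong refl)
    fix s u assume u: "u \<in> U"
    then show "pmf J (s, u) * log 2 (pmf J (s, u) / (pmf (map_pmf fst J) s * pmf (map_pmf snd J) u)) =
       P u * pmf (V u) s * ln (pmf (V u) s / pmf p s) / ln 2"
      using U(2)[OF u] by (simp add: J Pu p log_def mult.commute)
  qed
  also have "\<dots> = mixture_info U P V p / ln 2"
    by (simp add: mixture_info_eq[OF m] sum_divide_distrib sum.swap[of _ U UNIV])
  finally show ?thesis .
qed

lemma pmf_joint_pmf: "pmf (joint_pmf p W) (s, u) = pmf p s * pmf (W s) u" for p :: "'a::finite pmf"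
proof -
  have "pmf (map_pmf (Pair a) (W a)) (s, u) = (if a = s then pmf (W s) u else 0)" for a
    using pmf_map_inj'[of "Pair s" "W s" u] by (auto simp: pmf_map_outside inj_on_def intro!: pmf_map_outside)
  then have "(\<Sum>a\<in>UNIV. pmf (map_pmf (Pair a) (W a)) (s, u) * pmf p a) = (\<Sum>a\<in>UNIV. if a = s then pmf p s * pmf (W s) u else 0)"
    by (intro sum.cong refl) (metis mult.commute mult_zero_left)
  then show ?thesis
    unfolding joint_pmf_def pmf_bind by (subst integral_measure_pmf_real[of UNIV]) auto
qed

lemma map_fst_joint_pmf: "map_pmf fst (joint_pmf p W) = p"
  by (simp add: joint_pmf_def map_bind_pmf pmf.map_comp o_def bind_return_pmf')

text \<open>The component at u is the product of the three conditional marginals given u. Values u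
  of probability zero are dropped, because the weights of a mixture are positive.\<close>

lemma mixture_of_factorization:
  fixes p :: "('x::finite \<times> 'y::finite \<times> 'z::finite) pmf" and W :: "'x \<times> 'y \<times> 'z \<Rightarrow> nat pmf"
  assumes U: "finite U" "\<And>s. set_pmf (W s) \<subseteq> U" and fact: "factorizes (joint_pmf p W)"
  shows "\<exists>U' P V. product_mixture U' P V p \<and> mutual_info (joint_pmf p W) = mixture_info U' P V p / ln 2"
proof -
  define J where "J = joint_pmf p W"
  define P where "P = (\<lambda>u. \<P>(\<omega> in measure_pmf J. snd \<omega> = u))"
  define U' where "U' = {u \<in> U. P u > 0}"
  define Cnd where "Cnd = (\<lambda>u. cond_pmf J {\<omega>. snd \<omega> = u})"
  define A where "A = (\<lambda>u. map_pmf (\<lambda>\<omega>. fst (fst \<omega>)) (Cnd u))"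
  define B where "B = (\<lambda>u. map_pmf (\<lambda>\<omega>. fst (snd (fst \<omega>))) (Cnd u))"
  define C where "C = (\<lambda>u. map_pmf (\<lambda>\<omega>. snd (snd (fst \<omega>))) (Cnd u))"
  define V where "V = (\<lambda>u. pair_pmf (A u) (pair_pmf (B u) (C u)))"
  \<comment> \<open>Identifies conditioning by \<open>cond_pmf\<close>, which makes sense only on an
    event of positive probability, with the conditional probabilities in
    \<open>factorizes\<close>.\<close>
  have cond: "pmf (map_pmf f (Cnd u)) x = \<P>(\<omega> in measure_pmf J. f \<omega> = x \<bar> snd \<omega> = u)"
    if "P u > 0" for f :: "_ \<Rightarrow> 'w" and u x
  proof -
    have ne: "set_pmf J \<inter> {\<omega>. snd \<omega> = u} \<noteq> {}"
      using that by (auto simp: P_def measure_pmf_zero_iff)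
        (metis (mono_tags, lifting) disjoint_iff less_irrefl measure_pmf_zero_iff mem_Collect_eq)
    have "pmf (map_pmf f (Cnd u)) x = measure (uniform_measure J {\<omega>. snd \<omega> = u}) {\<omega>. f \<omega> = x}"
      by (simp add: pmf_map vimage_def Cnd_def cond_pmf.rep_eq[OF ne])
    also have "\<dots> = \<P>(\<omega> in measure_pmf J. f \<omega> = x \<bar> snd \<omega> = u)"
      using measure_pmf.measure_uniform_measure_eq_cond_prob[where M = J and P = "\<lambda>\<omega>. f \<omega> = x" and Q = "\<lambda>\<omega>. snd \<omega> = u"]
      by simp
    finally show ?thesis .
  qed
  have Pnn: "0 \<le> P u" for u by (simp add: P_def)
  have P0: "pmf J (s, u) = 0" if "u \<notin> U'" for s u
  proof (cases "u \<in> U")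
    case True
    then have "P u = 0" using that Pnn[of u] by (simp add: U'_def)
    moreover have "pmf J (s, u) \<le> P u"
      unfolding P_def pmf.rep_eq by (intro measure_pmf.finite_measure_mono) auto
    ultimately show ?thesis using pmf_nonneg[of J "(s, u)"] by linarith
  next
    case False
    then have "pmf (W s) u = 0" using U(2)[of s] by (auto simp: set_pmf_iff)
    then show ?thesis by (simp add: J_def pmf_joint_pmf)
  qed
  have J: "pmf J (s, u) = (if u \<in> U' then P u * pmf (V u) s else 0)" for s u
  proof (cases "u \<in> U'")
    case True
    then have u: "P u > 0" by (simp add: U'_def)
    obtain x y z where s: "s = (x, y, z)" by (cases s)
    have "pmf J ((x, y, z), u) = P u * pmf (A u) x * pmf (B u) y * pmf (C u) z"
      using fact unfolding J_def[symmetric] factorizes_def A_def B_def C_def cond[OF u] P_def by blast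
    then show ?thesis using True by (simp add: s V_def pmf_pair)
  qed (use P0 in simp)
  have p: "pmf p s = (\<Sum>u\<in>U'. P u * pmf (V u) s)" for s
  proof -
    have "(\<Sum>u\<in>U. pmf (W s) u) = 1" using U by (intro sum_pmf_eq_1) auto
    then have "pmf p s = (\<Sum>u\<in>U. pmf J (s, u))"
      by (simp add: J_def pmf_joint_pmf flip: sum_distrib_left)
    also have "\<dots> = (\<Sum>u\<in>U'. pmf J (s, u))"
      using U P0 by (intro sum.mono_neutral_right) (auto simp: U'_def)
    finally show ?thesis by (simp add: J)
  qed
  have "1 = (\<Sum>s\<in>UNIV. pmf p s)" by (simp add: sum_pmf_eq_1)
  also have "\<dots> = (\<Sum>u\<in>U'. \<Sum>s\<in>UNIV. P u * pmf (V u) s)" unfolding p by (rule sum.swap)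
  also have "\<dots> = sum P U'" by (simp add: sum_pmf_eq_1 flip: sum_distrib_left)
  finally have "sum P U' = 1" ..
  then have m: "product_mixture U' P V p"
    using U p unfolding product_mixture_def product_dist_def
    by (auto simp: U'_def V_def simp del: split_paired_All)
  then show ?thesis
    using mutual_info_mixture[OF m J] map_fst_joint_pmf unfolding J_def by blast
qed

text \<open>\<open>W\<close> is given by Bayes' rule, P(u) V_u(s) / p(s), so that the joint mass is
  P(u) V_u(s) again.\<close>

lemma factorization_of_mixture:
  fixes p :: "('x::finite \<times> 'y::finite \<times> 'z::finite) pmf"
  assumes m: "product_mixture U P V p"
  shows "\<exists>W. (\<forall>s. set_pmf (W s) \<subseteq> U) \<and> factorizes (joint_pmf p W) \<and>
     mutual_info (joint_pmf p W) = mixture_info U P V p / ln 2"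
proof -
  note D = product_mixtureD[OF m]
  have "\<exists>W. \<forall>u. pmf W u = (if u \<in> U then P u * pmf (V u) s / pmf p s else 0)" if s: "pmf p s > 0" for s
  proof -
    let ?f = "\<lambda>u. if u \<in> U then P u * pmf (V u) s / pmf p s else 0"
    have nn: "0 \<le> ?f u" for u using D(2)[of u] s by (auto simp: less_imp_le)
    have "(\<integral>\<^sup>+u. ennreal (?f u) \<partial>count_space UNIV) = (\<Sum>u\<in>U. ennreal (?f u))"
      using D(1) by (intro nn_integral_count_space'[of U, THEN trans]) auto
    also have "\<dots> = ennreal (\<Sum>u\<in>U. ?f u)" using nn by (rule sum_ennreal)
    also have "(\<Sum>u\<in>U. ?f u) = 1"
      using D(5)[of s] s by (simp flip: sum_divide_distrib)
    finally show ?thesis using pmf_embed_pmf[of ?f] nn by (intro exI[of _ "embed_pmf ?f"]) auto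
  qed
  then have "\<forall>s. \<exists>W. pmf p s > 0 \<longrightarrow> (\<forall>u. pmf W u = (if u \<in> U then P u * pmf (V u) s / pmf p s else 0))"
    by blast
  from choice[OF this] obtain W0 where
    W0: "\<And>s u. pmf p s > 0 \<Longrightarrow> pmf (W0 s) u = (if u \<in> U then P u * pmf (V u) s / pmf p s else 0)" by blast
  have "U \<noteq> {}" using D(3) by auto
  then obtain u0 where u0: "u0 \<in> U" by blast
  \<comment> \<open>At letters of probability zero Bayes' rule says nothing; a point mass in
    \<open>U\<close> keeps the support condition there.\<close>
  define W where "W = (\<lambda>s. if pmf p s > 0 then W0 s else return_pmf u0)"
  define J where "J = joint_pmf p W"
  have J: "pmf J (s, u) = (if u \<in> U then P u * pmf (V u) s else 0)" for s u
  proof (cases "pmf p s > 0")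
    case True
    then show ?thesis by (simp add: J_def pmf_joint_pmf W_def W0)
  next
    case False
    then have "pmf (V u) s = 0" if "u \<in> U"
      using product_mixture_pos[OF m that, of s] by (auto simp: less_le)
    moreover have "pmf p s = 0" using False by (simp add: less_le)
    ultimately show ?thesis by (simp add: J_def pmf_joint_pmf)
  qed
  \<comment> \<open>All events in \<open>factorizes\<close> are cylinders of this form.\<close>
  have mJ: "measure J (S \<times> {u}) = (if u \<in> U then P u * (\<Sum>s\<in>S. pmf (V u) s) else 0)" for S u
  proof -
    have "measure J (S \<times> {u}) = sum (pmf J) (S \<times> {u})" by (rule measure_measure_pmf_finite) simp
    also have "\<dots> = (\<Sum>s\<in>S. pmf J (s, u))"
      by (intro sum.reindex_bij_witness[of _ "\<lambda>s. (s, u)" fst]) auto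
    finally show ?thesis by (simp add: J sum_distrib_left)
  qed
  have "factorizes J"
    unfolding factorizes_def
  proof (intro allI)
    fix x y z u
    have c: "measure J {\<omega>. f (fst \<omega>) = w \<and> snd \<omega> = u} = measure J ({s. f s = w} \<times> {u})" for f :: "_ \<Rightarrow> 'w" and w
      by (intro arg_cong[where f = "measure _"]) auto
    have c1: "measure J {\<omega>. snd \<omega> = u} = measure J (UNIV \<times> {u})"
      by (intro arg_cong[where f = "measure _"]) auto
    show "pmf J ((x, y, z), u) =
        \<P>(\<omega> in measure_pmf J. snd \<omega> = u) *
        \<P>(\<omega> in measure_pmf J. fst (fst \<omega>) = x \<bar> snd \<omega> = u) *
        \<P>(\<omega> in measure_pmf J. fst (snd (fst \<omega>)) = y \<bar> snd \<omega> = u) *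
        \<P>(\<omega> in measure_pmf J. snd (snd (fst \<omega>)) = z \<bar> snd \<omega> = u)"
    proof (cases "u \<in> U")
      case True
      obtain A B C where V: "V u = pair_pmf A (pair_pmf B C)"
        using D(4)[OF True] by (auto simp: product_dist_def)
      have cond: "\<P>(\<omega> in measure_pmf J. f (fst \<omega>) = w \<bar> snd \<omega> = u) = pmf (map_pmf f (V u)) w" for f :: "_ \<Rightarrow> 'w" and w
      proof -
        have "(\<Sum>s | f s = w. pmf (V u) s) = pmf (map_pmf f (V u)) w"
          by (simp add: pmf_map vimage_def measure_measure_pmf_finite)
        then show ?thesis using True D(2)[OF True]
          by (simp add: cond_prob_def c c1 mJ sum_pmf_eq_1)
      qed
      have "map_pmf fst (V u) = A" "map_pmf (\<lambda>s. fst (snd s)) (V u) = B" "map_pmf (\<lambda>s. snd (snd s)) (V u) = C"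
        using map_fst_pair_pmf map_snd_pair_pmf
        unfolding V by (simp_all add: pmf.map_comp[symmetric, unfolded o_def] map_fst_pair_pmf map_snd_pair_pmf)
      then show ?thesis
        using cond[of fst x] cond[of "\<lambda>s. fst (snd s)" y] cond[of "\<lambda>s. snd (snd s)" z] True
        by (simp add: J V pmf_pair c1 mJ sum_pmf_eq_1)
    next
      case False
      then show ?thesis by (simp add: J c1 mJ)
    qed
  qed
  moreover have "set_pmf (W s) \<subseteq> U" for s
    using u0 W0[of s] by (auto simp: W_def set_pmf_iff split: if_splits)
  moreover have "mutual_info J = mixture_info U P V p / ln 2"
    by (rule mutual_info_mixture[OF m J]) (simp add: J_def map_fst_joint_pmf)
  ultimately show ?thesis unfolding J_def by blast
qed

subsection \<open>The convex hull of product distributions and their entropies\<close>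

text \<open>More than CARD('s) vectors are linearly dependent; the weights are moved along a
  dependency until one of them vanishes. Since all coordinate sums are 1, a linear dependency
  preserves the total weight. Caratheodory for the pairs (v, H v) would leave one point more; asking
  only that the mean of \<open>H\<close> not decrease saves it.\<close>

lemma positive_weights_reduce_support:
  fixes T :: "(real ^ 's::finite) set" and H :: "real ^ 's \<Rightarrow> real"
  assumes "finite T" "\<And>v. v \<in> T \<Longrightarrow> (\<Sum>s\<in>UNIV. v $ s) = 1" "\<And>v. v \<in> T \<Longrightarrow> 0 < u v"
  shows "\<exists>T' u'. T' \<subseteq> T \<and> card T' \<le> CARD('s) \<and> (\<forall>v\<in>T'. 0 < u' v) \<and> sum u' T' = sum u T \<and>
    (\<Sum>v\<in>T'. u' v *\<^sub>R v) = (\<Sum>v\<in>T. u v *\<^sub>R v) \<and> (\<Sum>v\<in>T. u v * H v) \<le> (\<Sum>v\<in>T'. u' v * H v)"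
  using assms
proof (induction "card T" arbitrary: T u rule: less_induct)
  case less
  show ?case
  proof (cases "card T \<le> CARD('s)")
    case True
    then show ?thesis using less.prems by blast
  next
    case False
    then have "dependent T" using less.prems(1) by (intro dependent_biggerset) auto
    then obtain c0 where c0: "(\<Sum>v\<in>T. c0 v *\<^sub>R v) = 0" "\<exists>v\<in>T. c0 v \<noteq> 0"
      using less.prems(1) by (auto simp: dependent_finite)
    \<comment> \<open>The sign is chosen so that moving along \<open>c\<close> does not decrease the
      mean of \<open>H\<close>.\<close>
    define c where "c = (\<lambda>v. (if (\<Sum>v\<in>T. c0 v * H v) \<ge> 0 then 1 else -1) * c0 v)"
    have c: "(\<Sum>v\<in>T. c v *\<^sub>R v) = 0" "\<exists>v\<in>T. c v \<noteq> 0" "(\<Sum>v\<in>T. c v * H v) \<ge> 0"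
      using c0 by (auto simp: c_def sum_negf)
    have csum: "sum c T = 0"
    proof -
      have "0 = (\<Sum>s\<in>UNIV. (\<Sum>v\<in>T. c v *\<^sub>R v) $ s)" by (simp add: c)
      also have "\<dots> = (\<Sum>v\<in>T. c v * (\<Sum>s\<in>UNIV. v $ s))"
        by (simp add: sum_distrib_left sum.swap[of _ UNIV T])
      also have "\<dots> = sum c T" using less.prems(2) by simp
      finally show ?thesis ..
    qed
    have "\<exists>v\<in>T. c v < 0"
    proof (rule ccontr)
      assume "\<not> ?thesis"
      then have "\<And>v. v \<in> T \<Longrightarrow> 0 \<le> c v" by force
      then have "\<forall>v\<in>T. c v = 0" using csum less.prems(1) by (simp add: sum_nonneg_eq_0_iff)
      then show False using c(2) by blast
    qed
    define N where "N = {v \<in> T. c v < 0}"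
    have N: "finite N" "N \<noteq> {}" using less.prems(1) \<open>\<exists>v\<in>T. c v < 0\<close> by (auto simp: N_def)
    \<comment> \<open>The largest step that keeps all weights nonnegative; it makes the weight at a
      minimiser \<open>w\<close> vanish.\<close>
    define t where "t = Min ((\<lambda>v. u v / - c v) ` N)"
    have "t \<in> (\<lambda>v. u v / - c v) ` N" unfolding t_def using N by (intro Min_in) auto
    then obtain w where w: "w \<in> N" "t = u w / - c w" by blast
    have t0: "t \<ge> 0" unfolding w(2) using w(1) less.prems(3)[of w]
      by (intro divide_nonneg_nonneg) (auto simp: N_def)
    define u1 where "u1 = (\<lambda>v. u v + t * c v)"
    have u1: "0 \<le> u1 v" if "v \<in> T" for v
    proof (cases "c v < 0")
      case True
      then have "t \<le> u v / - c v" using that N by (auto simp: t_def N_def intro!: Min_le)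
      moreover have "0 < - c v" using True by simp
      ultimately have "t * - c v \<le> u v" by (simp only: pos_le_divide_eq)
      then show ?thesis by (simp add: u1_def)
    next
      case False
      then show ?thesis using t0 less.prems(3)[OF that] by (simp add: u1_def)
    qed
    have u1w: "u1 w = 0" using w by (simp add: u1_def N_def)
    define T1 where "T1 = {v \<in> T. 0 < u1 v}"
    have T1: "finite T1" "T1 \<subseteq> T" using less.prems(1) by (auto simp: T1_def)
    have "w \<in> T" "w \<notin> T1" using w u1w by (auto simp: N_def T1_def)
    then have "card T1 < card T" using T1 less.prems(1) by (intro psubset_card_mono) auto
    \<comment> \<open>Used with \<open>F\<close> constant 1, the identity and \<open>H\<close>: the
      total weight, the barycentre and the mean of \<open>H\<close>.\<close>
    have restr: "(\<Sum>v\<in>T1. u1 v *\<^sub>R F v) = (\<Sum>v\<in>T. u v *\<^sub>R F v) + t *\<^sub>R (\<Sum>v\<in>T. c v *\<^sub>R F v)"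
      for F :: "real ^ 's \<Rightarrow> 'w::real_vector"
    proof -
      have "(\<Sum>v\<in>T1. u1 v *\<^sub>R F v) = (\<Sum>v\<in>T. u1 v *\<^sub>R F v)"
        using less.prems(1) u1 by (intro sum.mono_neutral_left) (force simp: T1_def less_le)+
      then show ?thesis by (simp add: u1_def scaleR_add_left sum.distrib scaleR_sum_right)
    qed
    have T1pos: "(\<Sum>s\<in>UNIV. v $ s) = 1" "0 < u1 v" if "v \<in> T1" for v
      using that less.prems(2) by (auto simp: T1_def)
    have "\<exists>T' u'. T' \<subseteq> T1 \<and> card T' \<le> CARD('s) \<and> (\<forall>v\<in>T'. 0 < u' v) \<and> sum u' T' = sum u1 T1 \<and>
      (\<Sum>v\<in>T'. u' v *\<^sub>R v) = (\<Sum>v\<in>T1. u1 v *\<^sub>R v) \<and> (\<Sum>v\<in>T1. u1 v * H v) \<le> (\<Sum>v\<in>T'. u' v * H v)"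
      by (rule less.hyps[OF \<open>card T1 < card T\<close> T1(1) T1pos])
    then obtain T' u' where T': "T' \<subseteq> T1" "card T' \<le> CARD('s)" "\<forall>v\<in>T'. 0 < u' v" "sum u' T' = sum u1 T1"
      "(\<Sum>v\<in>T'. u' v *\<^sub>R v) = (\<Sum>v\<in>T1. u1 v *\<^sub>R v)" "(\<Sum>v\<in>T1. u1 v * H v) \<le> (\<Sum>v\<in>T'. u' v * H v)"
      by (elim exE conjE) rule
    have "T' \<subseteq> T" using T'(1) T1(2) by (rule subset_trans)
    moreover have "sum u' T' = sum u T" using restr[of "\<lambda>_. 1::real"] csum T'(4) by simp
    moreover have "(\<Sum>v\<in>T'. u' v *\<^sub>R v) = (\<Sum>v\<in>T. u v *\<^sub>R v)" using restr[of "\<lambda>v. v"] c(1) T'(5) by simp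
    moreover have "(\<Sum>v\<in>T. u v * H v) \<le> (\<Sum>v\<in>T1. u1 v * H v)"
      using restr[of H] mult_nonneg_nonneg[OF t0 c(3)] by simp
    then have "(\<Sum>v\<in>T. u v * H v) \<le> (\<Sum>v\<in>T'. u' v * H v)" using T'(6) by (rule order_trans)
    ultimately show ?thesis using T'(2,3) by blast
  qed
qed

section \<open>Compactness of the set of product distributions\<close>

definition prob_simplex :: "(real ^ 'a::finite) set" where
  "prob_simplex = {v. (\<forall>i. 0 \<le> v $ i) \<and> (\<Sum>i\<in>UNIV. v $ i) = 1}"

lemma range_pmf_vec: "range pmf_vec = (prob_simplex :: (real ^ 'a::finite) set)"
proof
  show "range pmf_vec \<subseteq> (prob_simplex :: (real ^ 'a) set)"
    by (auto simp: prob_simplex_def pmf_vec_def sum_pmf_eq_1)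
  show "(prob_simplex :: (real ^ 'a) set) \<subseteq> range pmf_vec"
  proof
    fix v :: "real ^ 'a" assume v: "v \<in> prob_simplex"
    have "(\<integral>\<^sup>+i. ennreal (v $ i) \<partial>count_space UNIV) = (\<Sum>i\<in>UNIV. ennreal (v $ i))"
      by (simp add: nn_integral_count_space_finite)
    also have "\<dots> = ennreal (\<Sum>i\<in>UNIV. v $ i)" using v by (intro sum_ennreal) (auto simp: prob_simplex_def)
    finally have "pmf (embed_pmf (($) v)) i = v $ i" for i
      using v by (intro pmf_embed_pmf) (auto simp: prob_simplex_def)
    then have "v = pmf_vec (embed_pmf (($) v))" by (simp add: pmf_vec_def vec_eq_iff)
    then show "v \<in> range pmf_vec" by blast
  qed
qed

lemma compact_prob_simplex: "compact (prob_simplex :: (real ^ 'a::finite) set)"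
proof -
  have "closed (prob_simplex :: (real ^ 'a) set)"
    unfolding prob_simplex_def
    by (intro closed_Collect_conj closed_Collect_all closed_Collect_le closed_Collect_eq continuous_intros)
  moreover have "norm v \<le> 1" if "v \<in> prob_simplex" for v :: "real ^ 'a"
    using norm_le_l1_cart[of v] that by (simp add: prob_simplex_def)
  then have "bounded (prob_simplex :: (real ^ 'a) set)" by (auto simp: bounded_iff)
  ultimately show ?thesis by (simp add: compact_eq_bounded_closed)
qed

text \<open>The set is the image of a product of three simplices under the continuous map that
  multiplies coordinates.\<close>

lemma compact_product_dists:
  "compact (pmf_vec ` {v :: ('x::finite \<times> 'y::finite \<times> 'z::finite) pmf. product_dist v})"
proof -
  let ?F = "\<lambda>(a :: real ^ 'x, b :: real ^ 'y, c :: real ^ 'z). (\<chi> s. a $ fst s * (b $ fst (snd s) * c $ snd (snd s))) :: real ^ ('x \<times> 'y \<times> 'z)"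
  have F: "pmf_vec (pair_pmf A (pair_pmf B C)) = ?F (pmf_vec A, pmf_vec B, pmf_vec C)" for A B C
    by (simp add: pmf_vec_def vec_eq_iff pmf_pair)
  have "pmf_vec ` {v. product_dist v} = ?F ` (prob_simplex \<times> prob_simplex \<times> prob_simplex)"
  proof (intro set_eqI iffI)
    fix w assume "w \<in> pmf_vec ` {v :: ('x \<times> 'y \<times> 'z) pmf. product_dist v}"
    then obtain A B C where "w = pmf_vec (pair_pmf A (pair_pmf B C))" by (auto simp: product_dist_def)
    then have "w = ?F (pmf_vec A, pmf_vec B, pmf_vec C)" by (simp only: F)
    moreover have "(pmf_vec A, pmf_vec B, pmf_vec C) \<in> prob_simplex \<times> prob_simplex \<times> prob_simplex"
      by (simp flip: range_pmf_vec)
    ultimately show "w \<in> ?F ` (prob_simplex \<times> prob_simplex \<times> prob_simplex)" by (rule image_eqI)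
  next
    fix w assume "w \<in> ?F ` (prob_simplex \<times> prob_simplex \<times> prob_simplex)"
    then obtain a b c where w: "w = ?F (a, b, c)" "a \<in> prob_simplex" "b \<in> prob_simplex" "c \<in> prob_simplex"
      by blast
    then obtain A B C where "a = pmf_vec A" "b = pmf_vec B" "c = pmf_vec C"
      unfolding range_pmf_vec[symmetric] by blast
    then have "w = pmf_vec (pair_pmf A (pair_pmf B C))" using w(1) by (simp only: F)
    then show "w \<in> pmf_vec ` {v. product_dist v}" by (auto simp: product_dist_def)
  qed
  moreover have "continuous_on UNIV ?F"
    unfolding split_def by (intro continuous_on_vec_lambda continuous_intros)
  ultimately show ?thesis
    by (auto intro!: compact_continuous_image compact_Times compact_prob_simplex intro: continuous_on_subset)
qed

section \<open>Continuity of the entropy\<close>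

definition vec_entropy :: "real ^ 'a::finite \<Rightarrow> real" where
  "vec_entropy v = - (\<Sum>i\<in>UNIV. v $ i * ln (v $ i))"

lemma vec_entropy_pmf_vec: "vec_entropy (pmf_vec p) = entf UNIV (pmf p)"
  by (simp add: vec_entropy_def entf_def pmf_vec_def)

text \<open>With y = sqrt |x| the left side is 2 y (- y ln y), and - ln y \<le> 1 / y - 1 bounds the
  last factor by 1. Negative x are covered since ln x = ln |x| for \<open>ln\<close>, so the limit
  at 0 can be taken from both sides.\<close>

lemma abs_x_ln_x_le:
  fixes x :: real
  assumes "\<bar>x\<bar> < 1"
  shows "\<bar>x * ln x\<bar> \<le> 2 * sqrt \<bar>x\<bar>"
proof (cases "x = 0")
  case False
  define y where "y = sqrt \<bar>x\<bar>"
  have y: "0 < y" "y < 1" "\<bar>x\<bar> = y\<^sup>2" using False assms by (auto simp: y_def)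
  have "ln x = ln \<bar>x\<bar>" by (simp add: abs_if ln_minus)
  also have "\<dots> = 2 * ln y" using y by (simp add: ln_realpow)
  finally have "\<bar>x * ln x\<bar> = y * (y * (2 * (- ln y)))"
    using y by (simp add: abs_mult power2_eq_square ln_less_zero)
  moreover have "- ln y \<le> 1 / y - 1" using ln_le_minus_one[of "1 / y"] y by (simp add: ln_div)
  then have "y * (- ln y) \<le> y * (1 / y - 1)" using y by (intro mult_left_mono) auto
  then have "y * (- ln y) \<le> 1" using y by (simp add: right_diff_distrib)
  then have "(2 * y) * (y * (- ln y)) \<le> (2 * y) * 1" using y by (intro mult_left_mono) auto
  ultimately show ?thesis unfolding y_def[symmetric] by (simp only: ac_simps)
qed auto

lemma isCont_x_ln_x: "isCont (\<lambda>x::real. x * ln x) x"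
proof (cases "x = 0")
  case True
  have "((\<lambda>x::real. x * ln x) \<longlongrightarrow> 0) (at 0)"
  proof (rule Lim_null_comparison)
    have "\<forall>\<^sub>F x::real in at 0. \<bar>x\<bar> < 1"
      using eventually_at_ball[of 1 "0::real"] by (rule eventually_mono) auto
    then show "\<forall>\<^sub>F x::real in at 0. norm (x * ln x) \<le> 2 * sqrt \<bar>x\<bar>"
      by (rule eventually_mono) (use abs_x_ln_x_le in auto)
    have "((\<lambda>x::real. 2 * sqrt \<bar>x\<bar>) \<longlongrightarrow> 2 * sqrt \<bar>0\<bar>) (at 0)" by (intro tendsto_intros)
    then show "((\<lambda>x::real. 2 * sqrt \<bar>x\<bar>) \<longlongrightarrow> 0) (at 0)" by simp
  qed
  then show ?thesis using True by (simp add: isCont_def)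
next
  case False
  then show ?thesis by (intro continuous_intros) auto
qed

lemma continuous_on_vec_entropy: "continuous_on S vec_entropy"
proof -
  have "continuous_on UNIV (\<lambda>x::real. x * ln x)"
    using isCont_x_ln_x by (simp add: continuous_on_eq_continuous_at)
  then have "continuous_on S (\<lambda>v. (\<lambda>x::real. x * ln x) (v $ i))" for i
    by (rule continuous_on_compose2) (auto intro!: continuous_intros)
  then show ?thesis unfolding vec_entropy_def by (intro continuous_on_minus continuous_on_sum)
qed

text \<open>Pairs of a mixture of product laws and its conditional entropy given the component. With
  the entropy as a coordinate, the bound on the information is a lower bound on that coordinate and
  passes to limits.\<close>

definition entropy_hull :: "((real ^ ('x::finite \<times> 'y::finite \<times> 'z::finite)) \<times> real) set" where
  "entropy_hull = convex hull ((\<lambda>v. (v, vec_entropy v)) ` (pmf_vec ` {v. product_dist v}))"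

lemma compact_entropy_hull: "compact entropy_hull"
  unfolding entropy_hull_def
  by (intro compact_convex_hull compact_continuous_image compact_product_dists continuous_intros continuous_on_vec_entropy)

text \<open>A convex combination of points of the hull is a mixture. Reducing its support can only
  raise the mean entropy, hence the inequality for the information.\<close>

lemma entropy_hull_mixture:
  fixes p :: "('x::finite \<times> 'y::finite \<times> 'z::finite) pmf"
  assumes "(pmf_vec p, h) \<in> entropy_hull"
  shows "\<exists>U P V. product_mixture U P V p \<and> card U \<le> CARD('x \<times> 'y \<times> 'z) \<and>
     mixture_info U P V p \<le> entf UNIV (pmf p) - h"
proof -
  define PV where "PV = pmf_vec ` {v :: ('x \<times> 'y \<times> 'z) pmf. product_dist v}"
  obtain S u where S: "finite S" "S \<subseteq> (\<lambda>v. (v, vec_entropy v)) ` PV" "\<And>x. x \<in> S \<Longrightarrow> 0 \<le> u x"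
     "sum u S = 1" "(\<Sum>x\<in>S. u x *\<^sub>R x) = (pmf_vec p, h)"
    using assms unfolding entropy_hull_def PV_def[symmetric] convex_hull_explicit by blast
  \<comment> \<open>The points of \<open>S\<close> lie on the graph of \<open>vec_entropy\<close>,
    so first components suffice as labels; points of weight zero are dropped.\<close>
  define T where "T = {v \<in> fst ` S. u (v, vec_entropy v) > 0}"
  have T: "finite T" "T \<subseteq> PV" using S(1,2) by (auto simp: T_def)
  have sumT: "(\<Sum>x\<in>S. u x *\<^sub>R F x) = (\<Sum>v\<in>T. u (v, vec_entropy v) *\<^sub>R F (v, vec_entropy v))"
    for F :: "_ \<Rightarrow> 'w::real_vector"
  proof -
    have e: "(fst x, vec_entropy (fst x)) = x" if "x \<in> S" for x using that S(2) by auto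
    have "(\<Sum>x\<in>S. u x *\<^sub>R F x) = (\<Sum>v\<in>fst ` S. u (v, vec_entropy v) *\<^sub>R F (v, vec_entropy v))"
      using e by (intro sum.reindex_bij_witness[of _ "\<lambda>v. (v, vec_entropy v)" fst]) force+
    also have "\<dots> = (\<Sum>v\<in>T. u (v, vec_entropy v) *\<^sub>R F (v, vec_entropy v))"
    proof (intro sum.mono_neutral_right ballI)
      fix v assume v: "v \<in> fst ` S - T"
      then have "(v, vec_entropy v) \<in> S" using e by force
      then have "u (v, vec_entropy v) = 0" using S(3)[of "(v, vec_entropy v)"] v by (auto simp: T_def)
      then show "u (v, vec_entropy v) *\<^sub>R F (v, vec_entropy v) = 0" by simp
    qed (use S in \<open>auto simp: T_def\<close>)
    finally show ?thesis .
  qed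
  have one: "(\<Sum>s\<in>UNIV. v $ s) = 1" if "v \<in> T" for v
    using that T(2) by (auto simp: PV_def pmf_vec_def sum_pmf_eq_1)
  have Tpos: "0 < u (v, vec_entropy v)" if "v \<in> T" for v using that by (simp add: T_def)
  have "\<exists>T' u'. T' \<subseteq> T \<and> card T' \<le> CARD('x \<times> 'y \<times> 'z) \<and> (\<forall>v\<in>T'. 0 < u' v) \<and>
    sum u' T' = (\<Sum>v\<in>T. u (v, vec_entropy v)) \<and> (\<Sum>v\<in>T'. u' v *\<^sub>R v) = (\<Sum>v\<in>T. u (v, vec_entropy v) *\<^sub>R v) \<and>
    (\<Sum>v\<in>T. u (v, vec_entropy v) * vec_entropy v) \<le> (\<Sum>v\<in>T'. u' v * vec_entropy v)"
    by (rule positive_weights_reduce_support[OF T(1)]) (rule one Tpos, assumption)+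
  then obtain T' u' where T': "T' \<subseteq> T" "card T' \<le> CARD('x \<times> 'y \<times> 'z)" "\<forall>v\<in>T'. 0 < u' v"
    "sum u' T' = (\<Sum>v\<in>T. u (v, vec_entropy v))" "(\<Sum>v\<in>T'. u' v *\<^sub>R v) = (\<Sum>v\<in>T. u (v, vec_entropy v) *\<^sub>R v)"
    "(\<Sum>v\<in>T. u (v, vec_entropy v) * vec_entropy v) \<le> (\<Sum>v\<in>T'. u' v * vec_entropy v)"
    by (elim exE conjE) rule
  have "sum u' T' = 1" using T'(4) sumT[of "\<lambda>_. 1::real"] S(4) by simp
  moreover have "(\<Sum>v\<in>T'. u' v *\<^sub>R v) = pmf_vec p"
  proof -
    have "pmf_vec p = fst (\<Sum>x\<in>S. u x *\<^sub>R x)" by (simp add: S(5))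
    also have "\<dots> = (\<Sum>x\<in>S. u x *\<^sub>R fst x)" by (simp add: fst_sum)
    finally show ?thesis using T'(5) sumT[of fst] by simp
  qed
  moreover have "h \<le> (\<Sum>v\<in>T'. u' v * vec_entropy v)"
  proof -
    have "h = snd (\<Sum>x\<in>S. u x *\<^sub>R x)" by (simp add: S(5))
    also have "\<dots> = (\<Sum>x\<in>S. u x *\<^sub>R snd x)" by (simp add: snd_sum)
    finally show ?thesis using T'(6) sumT[of snd] by simp
  qed
  moreover have "finite T'" using T'(1) T(1) by (rule finite_subset)
  \<comment> \<open>The components are numbered, since the auxiliary alphabet is a set of
    naturals.\<close>
  moreover obtain e :: "nat \<Rightarrow> real ^ ('x \<times> 'y \<times> 'z)" where e: "bij_betw e {0..<card T'} T'"
    using ex_bij_betw_nat_finite[OF \<open>finite T'\<close>] by blast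
  moreover have "\<forall>v. \<exists>q. v \<in> T' \<longrightarrow> product_dist q \<and> pmf_vec q = v"
    using T'(1) T(2) by (auto simp: PV_def)
  from choice[OF this] obtain Q where Q: "\<And>v. v \<in> T' \<Longrightarrow> product_dist (Q v)" "\<And>v. v \<in> T' \<Longrightarrow> pmf_vec (Q v) = v"
    by blast
  ultimately have w: "sum u' T' = 1" "(\<Sum>v\<in>T'. u' v *\<^sub>R v) = pmf_vec p" "h \<le> (\<Sum>v\<in>T'. u' v * vec_entropy v)"
    by blast+
  let ?U = "{0..<card T'}" and ?P = "\<lambda>j. u' (e j)" and ?V = "\<lambda>j. Q (e j)"
  note reindex = sum.reindex_bij_betw[OF e]
  have eT: "e j \<in> T'" if "j < card T'" for j using e that by (auto simp: bij_betw_def)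
  have comp: "pmf (Q v) s = v $ s" if "v \<in> T'" for v s
  proof -
    have "pmf_vec (Q v) $ s = v $ s" using Q(2)[OF that] by simp
    then show ?thesis by (simp add: pmf_vec_def)
  qed
  have "product_mixture ?U ?P ?V p"
    unfolding product_mixture_def
  proof (intro conjI ballI allI)
    show "sum ?P ?U = 1" using w(1) reindex[of u'] by simp
    fix s
    have "pmf p s = (\<Sum>v\<in>T'. u' v *\<^sub>R v) $ s" unfolding w(2) by (simp add: pmf_vec_def)
    also have "\<dots> = (\<Sum>v\<in>T'. u' v * pmf (Q v) s)" by (simp add: comp)
    finally show "pmf p s = (\<Sum>j\<in>?U. ?P j * pmf (?V j) s)" using reindex[of "\<lambda>v. u' v * pmf (Q v) s"] by simp
  qed (use eT T'(3) Q in auto)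
  moreover have "mixture_info ?U ?P ?V p \<le> entf UNIV (pmf p) - h"
  proof -
    have "(\<Sum>v\<in>T'. u' v * vec_entropy v) = (\<Sum>v\<in>T'. u' v * entf UNIV (pmf (Q v)))"
      using Q(2) by (intro sum.cong refl) (simp flip: vec_entropy_pmf_vec)
    also have "\<dots> = (\<Sum>j\<in>?U. ?P j * entf UNIV (pmf (?V j)))"
      using reindex[of "\<lambda>v. u' v * entf UNIV (pmf (Q v))"] by simp
    finally show ?thesis using w(3) by (simp add: mixture_info_def)
  qed
  ultimately show ?thesis using T'(2) by (intro exI[of _ ?U] exI[of _ ?P] exI[of _ ?V]) simp
qed

subsection \<open>Converse\<close>

lemma sum_pmf_map:
  fixes c :: "'a \<Rightarrow> 's::finite" and \<phi> :: "'s \<Rightarrow> real"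
  assumes "finite B" "set_pmf Q \<subseteq> B"
  shows "(\<Sum>a\<in>B. pmf Q a * \<phi> (c a)) = (\<Sum>s\<in>UNIV. pmf (map_pmf c Q) s * \<phi> s)"
proof -
  have "(\<Sum>s\<in>UNIV. pmf (map_pmf c Q) s * \<phi> s) = measure_pmf.expectation (map_pmf c Q) \<phi>"
    by (subst integral_measure_pmf_real[of UNIV]) (auto simp: mult.commute)
  also have "\<dots> = measure_pmf.expectation Q (\<lambda>a. \<phi> (c a))" by simp
  also have "\<dots> = (\<Sum>a\<in>B. pmf Q a * \<phi> (c a))"
    using assms by (subst integral_measure_pmf_real[of B]) (auto simp: mult.commute)
  finally show ?thesis ..
qed

text \<open>Gibbs against the product of the letter marginals, which are positive wherever
  \<open>Q\<close> is.\<close>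

lemma entf_blocks_le:
  fixes Q :: "('x::finite list \<times> 'y::finite list \<times> 'z::finite list) pmf"
  assumes Q: "set_pmf Q \<subseteq> blocks n"
  shows "entf (blocks n) (pmf Q) \<le> (\<Sum>i<n. entf UNIV (pmf (map_pmf (letter i) Q)))"
proof -
  let ?m = "\<lambda>i. pmf (map_pmf (letter i) Q)"
  have pos: "?m i (letter i a) > 0" if "pmf Q a > 0" for i a
    using that by (auto simp: pmf_positive_iff)
  have "entf (blocks n) (pmf Q) \<le> - (\<Sum>a\<in>blocks n. pmf Q a * ln (\<Prod>i<n. ?m i (letter i a)))"
  proof (rule gibbs)
    show "(\<Sum>a\<in>blocks n. \<Prod>i<n. ?m i (letter i a)) \<le> sum (pmf Q) (blocks n)"
      using Q by (simp add: sum_blocks_prod[where g = "?m"] sum_pmf_eq_1)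
  qed (use pos in \<open>auto intro!: prod_nonneg prod_pos\<close>)
  also have "(\<Sum>a\<in>blocks n. pmf Q a * ln (\<Prod>i<n. ?m i (letter i a))) = (\<Sum>a\<in>blocks n. \<Sum>i<n. pmf Q a * ln (?m i (letter i a)))"
  proof (intro sum.cong refl)
    fix a
    show "pmf Q a * ln (\<Prod>i<n. ?m i (letter i a)) = (\<Sum>i<n. pmf Q a * ln (?m i (letter i a)))"
    proof (cases "pmf Q a > 0")
      case True
      have "?m i (letter i a) \<noteq> 0" for i using pos[OF True, of i] by linarith
      then have "ln (\<Prod>i<n. ?m i (letter i a)) = (\<Sum>i<n. ln (?m i (letter i a)))"
        using pos[OF True] by (intro ln_prod) auto
      then show ?thesis by (simp only: sum_distrib_left)
    next
      case False
      then have "pmf Q a = 0" by (simp add: less_le)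
      then show ?thesis by simp
    qed
  qed
  also have "\<dots> = (\<Sum>i<n. \<Sum>a\<in>blocks n. pmf Q a * ln (?m i (letter i a)))" by (rule sum.swap)
  also have "\<dots> = (\<Sum>i<n. \<Sum>s\<in>UNIV. ?m i s * ln (?m i s))"
    using Q by (intro sum.cong refl sum_pmf_map[where \<phi> = "\<lambda>s. ln (?m _ s)"]) auto
  finally show ?thesis by (simp add: entf_def sum_negf)
qed

text \<open>The mutual information between the block and the common randomness is at most $\ln M$,
  since each conditional law is dominated by $M$ times the mixture.\<close>

lemma entf_uniform_mixture_le:
  fixes P :: "'w \<Rightarrow> 'a \<Rightarrow> real"
  assumes W: "finite W" "W \<noteq> {}" and P: "\<And>w a. 0 \<le> P w a" "\<And>w. w \<in> W \<Longrightarrow> sum (P w) B = 1"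
    and I: "\<And>a. a \<in> B \<Longrightarrow> I a = (\<Sum>w\<in>W. P w a) / card W"
  shows "entf B I \<le> ln (card W) + (\<Sum>w\<in>W. entf B (P w)) / card W"
proof -
  define M where "M = real (card W)"
  have M: "M > 0" using W by (simp add: M_def card_gt_0_iff)
  have "- entf B (P w) \<le> ln M + (\<Sum>a\<in>B. P w a * ln (I a))" if w: "w \<in> W" for w
  proof -
    have "P w a * ln (P w a) \<le> P w a * ln M + P w a * ln (I a)" if a: "a \<in> B" for a
    proof (cases "P w a = 0")
      case False
      then have pos: "P w a > 0" using P(1)[of w a] by simp
      have "P w a \<le> (\<Sum>w\<in>W. P w a)" using w W P by (intro member_le_sum) auto
      then have le: "P w a \<le> M * I a" using M by (simp add: I[OF a] M_def)
      then have "0 < M * I a" using pos by linarith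
      then have "I a > 0" using M by (rule zero_less_mult_pos)
      then have "ln (P w a) \<le> ln M + ln (I a)"
        using le pos M by (simp flip: ln_mult_pos)
      then show ?thesis using pos by (simp flip: distrib_left)
    qed simp
    then have "(\<Sum>a\<in>B. P w a * ln (P w a)) \<le> (\<Sum>a\<in>B. P w a * ln M + P w a * ln (I a))"
      by (intro sum_mono)
    also have "\<dots> = ln M + (\<Sum>a\<in>B. P w a * ln (I a))"
      using P(2)[OF w] by (simp add: sum.distrib flip: sum_distrib_right)
    finally show ?thesis by (simp add: entf_def)
  qed
  then have "(\<Sum>w\<in>W. - entf B (P w)) \<le> (\<Sum>w\<in>W. ln M + (\<Sum>a\<in>B. P w a * ln (I a)))"
    by (intro sum_mono)
  also have "\<dots> = M * ln M + (\<Sum>a\<in>B. (\<Sum>w\<in>W. P w a) * ln (I a))"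
    by (simp add: sum.distrib M_def sum_distrib_right sum.swap[of _ W B])
  also have "(\<Sum>a\<in>B. (\<Sum>w\<in>W. P w a) * ln (I a)) = (\<Sum>a\<in>B. M * (I a * ln (I a)))"
    using M by (intro sum.cong refl) (simp add: I M_def)
  also have "\<dots> = - M * entf B I" by (simp add: entf_def flip: sum_distrib_left)
  finally have "M * entf B I \<le> M * ln M + (\<Sum>w\<in>W. entf B (P w))" by (simp add: sum_negf)
  then have "entf B I \<le> (M * ln M + (\<Sum>w\<in>W. entf B (P w))) / M" using M by (simp add: pos_le_divide_eq mult.commute)
  then show ?thesis using M by (simp add: add_divide_distrib M_def)
qed

text \<open>The block inequality is divided by n, and a coordinate at least as good as the average
  is kept. The distance bound is 2 T because taking a marginal does not increase the L1 distance and
  \<open>T\<close> is half of it.\<close>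

lemma single_letter_bound:
  fixes q :: "('x::finite \<times> 'y::finite \<times> 'z::finite) pmf"
  assumes R: "R \<ge> 0" and n: "n \<ge> 1"
    and dec: "is_decoder R n dx" "is_decoder R n dy" "is_decoder R n dz"
  defines "T \<equiv> tv_dist (blocks n) (pmf (induced_pmf R n dx dy dz)) (iid_mass q n)"
  shows "\<exists>v h. (v, h) \<in> entropy_hull \<and> (\<forall>s. \<bar>v $ s - pmf q s\<bar> \<le> 2 * T) \<and>
    entf UNIV (pmf q) - R * ln 2 - T * ln CARD('x \<times> 'y \<times> 'z) - 1 / n \<le> h"
proof -
  define W where "W = common_randomness R n"
  define P where "P = (\<lambda>w. pair_pmf (dx w) (pair_pmf (dy w) (dz w)))"
  define I where "I = induced_pmf R n dx dy dz"
  define N where "N = CARD('x \<times> 'y \<times> 'z)"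
  have W: "finite W" "W \<noteq> {}" "card W \<ge> 1" "real (card W) \<le> 2 powr (real n * R)"
    using common_randomness_nonempty[OF R, of n] card_common_randomness_bounds[OF R, of n] by (simp_all add: W_def)
  have I_bind: "I = bind_pmf (pmf_of_set W) P" by (simp add: I_def induced_pmf_def W_def P_def)
  have P: "set_pmf (P w) \<subseteq> blocks n" if "w \<in> W" for w
    using that dec by (auto simp: P_def blocks_def is_decoder_def W_def)
  have Iset: "set_pmf I \<subseteq> blocks n" using P W by (auto simp: I_bind set_pmf_of_set)
  have Ipmf: "pmf I a = (\<Sum>w\<in>W. pmf (P w) a) / card W" for a
    using W by (simp add: I_bind pmf_bind_pmf_of_set)
  let ?h = "\<lambda>i w. entf UNIV (pmf (map_pmf (letter i) (P w)))"
  have "n * entf UNIV (pmf q) \<le> entf (blocks n) (pmf I) + T * ln (card (blocks n :: ('x list \<times> 'y list \<times> 'z list) set)) + 1"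
    unfolding entf_iid[symmetric] T_def I_def[symmetric]
    using Iset by (intro entropy_tv_bound blocks_nonempty) (auto simp: sum_iid_mass iid_mass_nonneg sum_pmf_eq_1)
  also have "ln (card (blocks n :: ('x list \<times> 'y list \<times> 'z list) set)) = n * ln N"
    unfolding card_blocks N_def[symmetric] by (simp add: ln_realpow N_def)
  also have "entf (blocks n) (pmf I) \<le> ln (card W) + (\<Sum>w\<in>W. entf (blocks n) (pmf (P w))) / card W"
    using P by (intro entf_uniform_mixture_le W Ipmf) (auto simp: sum_pmf_eq_1)
  also have "ln (card W) \<le> n * R * ln 2"
  proof -
    have "ln (card W) \<le> ln (2 powr (real n * R))" using W by (intro ln_mono) auto
    then show ?thesis by (simp add: ln_powr)
  qed
  also have "(\<Sum>w\<in>W. entf (blocks n) (pmf (P w))) \<le> (\<Sum>w\<in>W. \<Sum>i<n. ?h i w)"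
    by (intro sum_mono entf_blocks_le P)
  also have "(\<Sum>w\<in>W. \<Sum>i<n. ?h i w) / card W = (\<Sum>i<n. (\<Sum>w\<in>W. ?h i w) / card W)"
    by (subst sum.swap) (simp add: sum_divide_distrib)
  finally have total: "n * entf UNIV (pmf q) \<le> n * R * ln 2 + (\<Sum>i<n. (\<Sum>w\<in>W. ?h i w) / card W) + T * (n * ln N) + 1"
    by (simp add: divide_right_mono)
  \<comment> \<open>The lower bound that \<open>total\<close> gives for the coordinate average of
    the conditional entropies.\<close>
  define b where "b = entf UNIV (pmf q) - R * ln 2 - T * ln N - 1 / n"
  have "\<exists>i<n. b \<le> (\<Sum>w\<in>W. ?h i w) / card W"
  proof (rule ccontr)
    assume "\<not> ?thesis"
    then have "(\<Sum>i<n. (\<Sum>w\<in>W. ?h i w) / card W) < (\<Sum>i<n. b)"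
      using n by (intro sum_strict_mono) (auto simp: not_le lessThan_empty_iff)
    also have "\<dots> = n * entf UNIV (pmf q) - n * R * ln 2 - T * (n * ln N) - 1"
      using n by (simp add: b_def right_diff_distrib)
    finally show False using total by linarith
  qed
  then obtain i where i: "i < n" "b \<le> (\<Sum>w\<in>W. ?h i w) / card W" by blast
  define h where "h = (\<Sum>w\<in>W. ?h i w) / card W"
  define v where "v = pmf_vec (map_pmf (letter i) I)"
  \<comment> \<open>The pair is the uniform average over \<omega> of points of the generating
    set.\<close>
  have "(v, h) = (\<Sum>w\<in>W. (1 / card W) *\<^sub>R (pmf_vec (map_pmf (letter i) (P w)), vec_entropy (pmf_vec (map_pmf (letter i) (P w)))))"
  proof (rule prod_eqI)
    have "pmf (map_pmf (letter i) I) s = (\<Sum>w\<in>W. pmf (map_pmf (letter i) (P w)) s) / card W" for s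
      using W by (simp add: I_bind map_bind_pmf pmf_bind_pmf_of_set)
    then show "fst (v, h) = fst (\<Sum>w\<in>W. (1 / card W) *\<^sub>R (pmf_vec (map_pmf (letter i) (P w)), vec_entropy (pmf_vec (map_pmf (letter i) (P w)))))"
      by (simp add: fst_sum v_def vec_eq_iff pmf_vec_def sum_divide_distrib)
    show "snd (v, h) = snd (\<Sum>w\<in>W. (1 / card W) *\<^sub>R (pmf_vec (map_pmf (letter i) (P w)), vec_entropy (pmf_vec (map_pmf (letter i) (P w)))))"
      by (simp add: snd_sum h_def vec_entropy_pmf_vec sum_divide_distrib)
  qed
  also have "\<dots> \<in> entropy_hull"
    unfolding entropy_hull_def
  proof (intro convex_sum W convex_convex_hull)
    fix w
    \<comment> \<open>Private randomness is independent, so given the common randomness the three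
      letters are independent.\<close>
    have "map_pmf (letter i) (P w) = pair_pmf (map_pmf (\<lambda>xs. xs ! i) (dx w)) (pair_pmf (map_pmf (\<lambda>ys. ys ! i) (dy w)) (map_pmf (\<lambda>zs. zs ! i) (dz w)))"
      unfolding P_def letter_def map_pair[symmetric]
      by (simp add: map_pair[symmetric] split_def)
    then have "product_dist (map_pmf (letter i) (P w))" by (auto simp: product_dist_def)
    then show "(pmf_vec (map_pmf (letter i) (P w)), vec_entropy (pmf_vec (map_pmf (letter i) (P w))))
       \<in> convex hull ((\<lambda>v. (v, vec_entropy v)) ` (pmf_vec ` {v. product_dist v}))"
      by (intro hull_inc imageI) simp
  qed (use W in auto)
  finally have "(v, h) \<in> entropy_hull" .
  moreover have "\<bar>v $ s - pmf q s\<bar> \<le> 2 * T" for s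
  proof -
    have "v $ s = (\<Sum>a\<in>blocks n. pmf I a * of_bool (letter i a = s))"
      using sum_pmf_map[OF finite_blocks Iset, of "\<lambda>t. of_bool (t = s)" "letter i"]
      by (simp add: v_def pmf_vec_def of_bool_def if_distrib cong: if_cong)
    moreover have "pmf q s = (\<Sum>a\<in>blocks n. iid_mass q n a * of_bool (letter i a = s))"
      using sum_blocks_iid_letter[OF i(1), of q "\<lambda>t. of_bool (t = s)"]
      by (simp add: of_bool_def if_distrib cong: if_cong)
    ultimately have "v $ s - pmf q s = (\<Sum>a\<in>blocks n. (pmf I a - iid_mass q n a) * of_bool (letter i a = s))"
      by (simp add: left_diff_distrib sum_subtractf)
    then have "\<bar>v $ s - pmf q s\<bar> \<le> (\<Sum>a\<in>blocks n. \<bar>(pmf I a - iid_mass q n a) * of_bool (letter i a = s)\<bar>)"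
      by (simp only: sum_abs)
    also have "\<dots> \<le> (\<Sum>a\<in>blocks n. \<bar>pmf I a - iid_mass q n a\<bar>)"
      by (intro sum_mono) (auto simp: abs_mult)
    finally show ?thesis by (simp add: T_def tv_dist_def I_def)
  qed
  ultimately show ?thesis using i(2) unfolding b_def h_def N_def by blast
qed

text \<open>Nothing forces \<open>h\<close> to converge, so compactness supplies a subsequence along
  which the pairs converge inside the hull.\<close>

lemma entropy_hull_limit:
  fixes v :: "nat \<Rightarrow> real ^ ('x::finite \<times> 'y::finite \<times> 'z::finite)"
  assumes "\<And>k. (v k, h k) \<in> entropy_hull" "v \<longlonglongrightarrow> w" "\<And>k. b k \<le> h k" "b \<longlonglongrightarrow> c"
  shows "\<exists>h'. (w, h') \<in> entropy_hull \<and> c \<le> h'"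
proof -
  obtain l r where l: "l \<in> entropy_hull" "strict_mono r" "((\<lambda>k. (v k, h k)) \<circ> r) \<longlonglongrightarrow> l"
    using compact_imp_seq_compact[OF compact_entropy_hull] assms(1)
    unfolding seq_compact_def by (metis (mono_tags, lifting))
  have lims: "(\<lambda>k. v (r k)) \<longlonglongrightarrow> fst l" "(\<lambda>k. h (r k)) \<longlonglongrightarrow> snd l"
    using tendsto_fst[OF l(3)] tendsto_snd[OF l(3)] by (simp_all add: o_def)
  have "(\<lambda>k. v (r k)) \<longlonglongrightarrow> w"
    using LIMSEQ_subseq_LIMSEQ[OF assms(2) l(2)] by (simp add: o_def)
  with lims(1) have "fst l = w" by (rule LIMSEQ_unique)
  have "(\<lambda>k. b (r k)) \<longlonglongrightarrow> c"
    using LIMSEQ_subseq_LIMSEQ[OF assms(4) l(2)] by (simp add: o_def)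
  then have "c \<le> snd l" using lims(2) by (rule LIMSEQ_le) (use assms(3) in blast)
  then have "fst l = w \<and> c \<le> snd l" using \<open>fst l = w\<close> by simp
  then show ?thesis using l(1) by (metis prod.collapse)
qed

lemma strongly_achievable_entropy_hull:
  fixes q :: "('x::finite \<times> 'y::finite \<times> 'z::finite) pmf"
  assumes R: "R \<ge> 0" and q: "strongly_achievable R q"
  shows "\<exists>h. (pmf_vec q, h) \<in> entropy_hull \<and> entf UNIV (pmf q) - R * ln 2 \<le> h"
proof -
  obtain dx dy dz where
    dec: "\<And>n. n \<ge> 1 \<Longrightarrow> is_decoder R n (dx n) \<and> is_decoder R n (dy n) \<and> is_decoder R n (dz n)" and
    lim: "(\<lambda>n. tv_dist (blocks n) (pmf (induced_pmf R n (dx n) (dy n) (dz n))) (iid_mass q n)) \<longlonglongrightarrow> 0"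
    using q unfolding strongly_achievable_def by blast
  \<comment> \<open>The shift restricts attention to block lengths at least 1, where the decoders
    are constrained.\<close>
  define T where "T = (\<lambda>k. tv_dist (blocks (Suc k)) (pmf (induced_pmf R (Suc k) (dx (Suc k)) (dy (Suc k)) (dz (Suc k)))) (iid_mass q (Suc k)))"
  have T: "T \<longlonglongrightarrow> 0" unfolding T_def using lim by (rule LIMSEQ_Suc)
  let ?b = "\<lambda>k. entf UNIV (pmf q) - R * ln 2 - T k * ln CARD('x \<times> 'y \<times> 'z) - 1 / Suc k"
  have "\<exists>x. x \<in> entropy_hull \<and> (\<forall>s. \<bar>fst x $ s - pmf q s\<bar> \<le> 2 * T k) \<and> ?b k \<le> snd x" for k
    using single_letter_bound[OF R, of "Suc k" "dx (Suc k)" "dy (Suc k)" "dz (Suc k)" q] dec[of "Suc k"]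
    unfolding T_def by force
  then have "\<forall>k. \<exists>x. x \<in> entropy_hull \<and> (\<forall>s. \<bar>fst x $ s - pmf q s\<bar> \<le> 2 * T k) \<and> ?b k \<le> snd x"
    by (rule allI)
  from choice[OF this] obtain x where x: "\<And>k. x k \<in> entropy_hull"
    "\<And>k s. \<bar>fst (x k) $ s - pmf q s\<bar> \<le> 2 * T k" "\<And>k. ?b k \<le> snd (x k)"
    by blast
  have "(\<lambda>k. fst (x k)) \<longlonglongrightarrow> pmf_vec q"
  proof (rule vec_tendstoI)
    fix s
    have "(\<lambda>k. fst (x k) $ s - pmf q s) \<longlonglongrightarrow> 0"
    proof (rule Lim_null_comparison)
      show "\<forall>\<^sub>F k in sequentially. norm (fst (x k) $ s - pmf q s) \<le> 2 * T k" using x(2) by simp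
      show "(\<lambda>k. 2 * T k) \<longlonglongrightarrow> 0" using tendsto_mult_left[OF T, of 2] by simp
    qed
    then show "(\<lambda>k. fst (x k) $ s) \<longlonglongrightarrow> pmf_vec q $ s" by (simp add: LIM_zero_iff pmf_vec_def)
  qed
  moreover have "?b \<longlonglongrightarrow> entf UNIV (pmf q) - R * ln 2 - 0 * ln CARD('x \<times> 'y \<times> 'z) - 0"
    using LIMSEQ_inverse_real_of_nat by (intro tendsto_intros T) (simp add: inverse_eq_divide)
  ultimately show ?thesis
    using entropy_hull_limit[of "\<lambda>k. fst (x k)" "\<lambda>k. snd (x k)" "pmf_vec q" ?b] x by simp
qed

text \<open>The entropy is continuous, so the lower bounds converge along a sequence of achievable
  laws, and the closed hull keeps the limit.\<close>

lemma strong_capacity_region_entropy_hull: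
  fixes p :: "('x::finite \<times> 'y::finite \<times> 'z::finite) pmf"
  assumes R: "R \<ge> 0" and p: "p \<in> strong_capacity_region R"
  shows "\<exists>h. (pmf_vec p, h) \<in> entropy_hull \<and> entf UNIV (pmf p) - R * ln 2 \<le> h"
proof -
  obtain f where f: "\<And>k. f k \<in> pmf_vec ` {q :: ('x \<times> 'y \<times> 'z) pmf. strongly_achievable R q}" "f \<longlonglongrightarrow> pmf_vec p"
    using p unfolding strong_capacity_region_def closure_sequential by blast
  have "\<exists>h. (f k, h) \<in> entropy_hull \<and> vec_entropy (f k) - R * ln 2 \<le> h" for k
    using f(1)[of k] strongly_achievable_entropy_hull[OF R] by (auto simp: vec_entropy_pmf_vec)
  then have "\<forall>k. \<exists>h. (f k, h) \<in> entropy_hull \<and> vec_entropy (f k) - R * ln 2 \<le> h" by (rule allI)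
  from choice[OF this] obtain h where h: "\<And>k. (f k, h k) \<in> entropy_hull" "\<And>k. vec_entropy (f k) - R * ln 2 \<le> h k"
    by blast
  have "(\<lambda>k. vec_entropy (f k)) \<longlonglongrightarrow> vec_entropy (pmf_vec p)"
    by (rule continuous_on_tendsto_compose[OF continuous_on_vec_entropy[of UNIV] f(2)]) simp_all
  then have "(\<lambda>k. vec_entropy (f k) - R * ln 2) \<longlonglongrightarrow> vec_entropy (pmf_vec p) - R * ln 2"
    by (intro tendsto_intros)
  then show ?thesis using entropy_hull_limit[OF h(1) f(2) h(2)] by (simp add: vec_entropy_pmf_vec)
qed

section \<open>Both inclusions for the capacity region\<close>

theorem theorem9:
  fixes R\<^sub>0 :: real
  assumes "R\<^sub>0 \<ge> 0"
  shows "(strong_capacity_region R\<^sub>0 :: ('x::finite \<times> 'y::finite \<times> 'z::finite) pmf set) =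
    {p. \<exists>(\<U> :: nat set) (W :: 'x \<times> 'y \<times> 'z \<Rightarrow> nat pmf).
          finite \<U> \<and> card \<U> \<le> CARD('x) * CARD('y) * CARD('z) \<and>
          (\<forall>s. set_pmf (W s) \<subseteq> \<U>) \<and>
          factorizes (joint_pmf p W) \<and>
          R\<^sub>0 \<ge> mutual_info (joint_pmf p W)}" (is "_ = ?S")
proof (intro set_eqI iffI)
  fix p :: "('x \<times> 'y \<times> 'z) pmf"
  assume "p \<in> strong_capacity_region R\<^sub>0"
  then obtain h where h: "(pmf_vec p, h) \<in> entropy_hull" "entf UNIV (pmf p) - R\<^sub>0 * ln 2 \<le> h"
    using strong_capacity_region_entropy_hull[OF assms] by blast
  obtain U P V where m: "product_mixture U P V p" "card U \<le> CARD('x \<times> 'y \<times> 'z)"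
    "mixture_info U P V p \<le> entf UNIV (pmf p) - h"
    using entropy_hull_mixture[OF h(1)] by blast
  have "mixture_info U P V p / ln 2 \<le> R\<^sub>0" using m(3) h(2) by (simp add: pos_divide_le_eq)
  moreover obtain W where "\<forall>s. set_pmf (W s) \<subseteq> U" "factorizes (joint_pmf p W)"
    "mutual_info (joint_pmf p W) = mixture_info U P V p / ln 2"
    using factorization_of_mixture[OF m(1)] by blast
  moreover have "finite U" "card U \<le> CARD('x) * CARD('y) * CARD('z)"
    using product_mixtureD(1)[OF m(1)] m(2) by (simp_all add: mult.assoc)
  ultimately show "p \<in> ?S" by (intro CollectI exI[of _ U] exI[of _ W] conjI) simp_all
next
  fix p :: "('x \<times> 'y \<times> 'z) pmf"
  assume "p \<in> ?S"
  then obtain \<U> and W :: "'x \<times> 'y \<times> 'z \<Rightarrow> nat pmf" where W: "finite \<U>" "\<And>s. set_pmf (W s) \<subseteq> \<U>"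
    "factorizes (joint_pmf p W)" "mutual_info (joint_pmf p W) \<le> R\<^sub>0" by blast
  obtain U P V where m: "product_mixture U P V p" "mutual_info (joint_pmf p W) = mixture_info U P V p / ln 2"
    using mixture_of_factorization[OF W(1-3)] by blast
  have "mixture_info U P V p \<le> R\<^sub>0 * ln 2" using W(4) m(2) by (simp add: pos_divide_le_eq)
  then show "p \<in> strong_capacity_region R\<^sub>0" by (rule mixture_in_strong_capacity_region[OF assms m(1)])
qed

end
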